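(* There exists a deterministic algorithm that, given a set of tuples $\mathcal{D} = \{t_1, \ldots, t_n\}$ with each $t_i \in \mathbb{R}^d$, a ranking $\pi$ over $\mathcal{D}$ and an integer $k$, does the following: if the Singleton Group Bonus Linear Ranking instance $(\mathcal{D},\pi,k)$ has a satisfying solution, then the algorithm returns a weight vector $w \in \mathbb{R}^d$ and a bonus vector $\mathbf{v} \in \mathbb{R}^n$ with at most $k$ non-zero entries such that sorting the tuples by $s_w(t_i) + v_i$ produces the ranking $\pi$. The algorithm runs in time $\mathcal{O}(n^{2d+1} \log n)$.
   Context: A ranking $\pi$ over $\mathcal{D}$ is a total order (sequence) of the $n$ tuples. For $w \in \mathbb{R}^d$ the linear utility function is $s_w(t) = \sum_{j=1}^d w_j t[j]$, where $t[j]$ is the $j$-th coordinate of $t$. "Sorting the tuples by $s_w(t_i)+v_i$ produces $\pi$" means that listing the tuples in decreasing order of their adjusted scores $s_w(t_i)+v_i$ yields $\pi$. The Singleton Group Bonus Linear Ranking problem asks, given $(\mathcal{D},\pi,k)$, whether there exist $w \in \mathbb{R}^d$ and $\mathbf{v}\in\mathbb{R}^n$ with at most $k$ non-zero entries such that sorting the tuples by $s_w(t_i)+v_i$ produces $\pi$; such a pair $(w,\mathbf{v})$ is a satisfying solution. *)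

theory Defs
  imports
    Complex_Main
    "HOL-Library.Landau_Symbols"
    "Jordan_Normal_Form.Matrix"
begin

section \<open>Singleton Group Bonus Linear Ranking\<close>

text \<open>
  The tuples \<open>t\<^sub>1, \<dots>, t\<^sub>n\<close> are the entries of the list \<open>D\<close>, indexed from 0. A ranking is
  given as the list of the tuple indices, best tuple first.
\<close>

definition tuple_set :: "nat \<Rightarrow> real vec list \<Rightarrow> bool" where
  "tuple_set d D \<longleftrightarrow> set D \<subseteq> carrier_vec d \<and> distinct D"

definition ranking :: "real vec list \<Rightarrow> nat list \<Rightarrow> bool" where
  "ranking D \<pi> \<longleftrightarrow> distinct \<pi> \<and> set \<pi> = {..<length D}"

definition utility :: "nat \<Rightarrow> real vec \<Rightarrow> real vec \<Rightarrow> real" where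
  "utility d w t = (\<Sum>j<d. w $ j * t $ j)"

text \<open>
  The adjusted scores have to be strictly decreasing along \<open>\<pi>\<close>: only then does sorting
  determine \<open>\<pi>\<close>. If ties were admitted, \<open>w = 0\<close> and \<open>v = 0\<close> would solve every instance.
\<close>

definition sorting_produces ::
    "nat \<Rightarrow> real vec list \<Rightarrow> real vec \<Rightarrow> real vec \<Rightarrow> nat list \<Rightarrow> bool" where
  "sorting_produces d D w v \<pi> \<longleftrightarrow>
     sorted_wrt (>) (map (\<lambda>i. utility d w (D ! i) + v $ i) \<pi>)"

definition satisfying_solution ::
    "nat \<Rightarrow> real vec list \<Rightarrow> nat list \<Rightarrow> int \<Rightarrow> real vec \<Rightarrow> real vec \<Rightarrow> bool" where
  "satisfying_solution d D \<pi> k w v \<longleftrightarrow>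
     w \<in> carrier_vec d \<and> v \<in> carrier_vec (length D) \<and>
     int (card {i. i < length D \<and> v $ i \<noteq> 0}) \<le> k \<and>
     sorting_produces d D w v \<pi>"


section \<open>The real RAM\<close>

text \<open>
  Algorithms are structured programs for the unit-cost real RAM. The memory consists of integer
  arrays and real arrays (a program mentions only finitely many of them); a scalar variable is
  cell 0 of an array. Array accesses may be indirect. Every arithmetic operation, comparison and
  memory access costs one unit. Integers can be converted to reals but not conversely (there is no
  floor function), there is no integer division, and the only constants are integers, so that no
  information can be hidden in a real constant. Division by zero yields zero.
\<close>

datatype iexp =
    IConst int
  | IRead string iexp
  | IAdd iexp iexp
  | ISub iexp iexp
  | IMul iexp iexp

datatype rexp =
    RInt iexp
  | RRead string iexp
  | RAdd rexp rexp
  | RSub rexp rexp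
  | RMul rexp rexp
  | RDiv rexp rexp

datatype bexp =
    ILess iexp iexp
  | RLess rexp rexp
  | BNot bexp
  | BAnd bexp bexp

datatype com =
    Skip
  | IWrite string iexp iexp  \<comment> \<open>array, index, value\<close>
  | RWrite string iexp rexp
  | Seq com com
  | If bexp com com
  | While bexp com

record state =
  imem :: "string \<Rightarrow> int \<Rightarrow> int"
  rmem :: "string \<Rightarrow> int \<Rightarrow> real"

primrec ival :: "iexp \<Rightarrow> state \<Rightarrow> int" where
  "ival (IConst c) s = c"
| "ival (IRead x a) s = imem s x (ival a s)"
| "ival (IAdd a b) s = ival a s + ival b s"
| "ival (ISub a b) s = ival a s - ival b s"
| "ival (IMul a b) s = ival a s * ival b s"

primrec rval :: "rexp \<Rightarrow> state \<Rightarrow> real" where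
  "rval (RInt a) s = of_int (ival a s)"
| "rval (RRead x a) s = rmem s x (ival a s)"
| "rval (RAdd a b) s = rval a s + rval b s"
| "rval (RSub a b) s = rval a s - rval b s"
| "rval (RMul a b) s = rval a s * rval b s"
| "rval (RDiv a b) s = rval a s / rval b s"

primrec bval :: "bexp \<Rightarrow> state \<Rightarrow> bool" where
  "bval (ILess a b) s \<longleftrightarrow> ival a s < ival b s"
| "bval (RLess a b) s \<longleftrightarrow> rval a s < rval b s"
| "bval (BNot b) s \<longleftrightarrow> \<not> bval b s"
| "bval (BAnd b c) s \<longleftrightarrow> bval b s \<and> bval c s"

primrec icost :: "iexp \<Rightarrow> nat" where
  "icost (IConst c) = 1"
| "icost (IRead x a) = 1 + icost a"
| "icost (IAdd a b) = 1 + icost a + icost b"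
| "icost (ISub a b) = 1 + icost a + icost b"
| "icost (IMul a b) = 1 + icost a + icost b"

primrec rcost :: "rexp \<Rightarrow> nat" where
  "rcost (RInt a) = 1 + icost a"
| "rcost (RRead x a) = 1 + icost a"
| "rcost (RAdd a b) = 1 + rcost a + rcost b"
| "rcost (RSub a b) = 1 + rcost a + rcost b"
| "rcost (RMul a b) = 1 + rcost a + rcost b"
| "rcost (RDiv a b) = 1 + rcost a + rcost b"

primrec bcost :: "bexp \<Rightarrow> nat" where
  "bcost (ILess a b) = 1 + icost a + icost b"
| "bcost (RLess a b) = 1 + rcost a + rcost b"
| "bcost (BNot b) = 1 + bcost b"
| "bcost (BAnd b c) = 1 + bcost b + bcost c"

definition iupdate :: "string \<Rightarrow> int \<Rightarrow> int \<Rightarrow> state \<Rightarrow> state" where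
  "iupdate x i z s = s\<lparr>imem := (imem s)(x := (imem s x)(i := z))\<rparr>"

definition rupdate :: "string \<Rightarrow> int \<Rightarrow> real \<Rightarrow> state \<Rightarrow> state" where
  "rupdate x i z s = s\<lparr>rmem := (rmem s)(x := (rmem s x)(i := z))\<rparr>"

text \<open>\<open>exec P s m s'\<close>: started in state \<open>s\<close>, the program \<open>P\<close> halts in state \<open>s'\<close> after \<open>m\<close> time units.\<close>

inductive exec :: "com \<Rightarrow> state \<Rightarrow> nat \<Rightarrow> state \<Rightarrow> bool" where
  Skip: "exec Skip s 1 s"
| IWrite: "exec (IWrite x a e) s (1 + icost a + icost e) (iupdate x (ival a s) (ival e s) s)"
| RWrite: "exec (RWrite x a e) s (1 + icost a + rcost e) (rupdate x (ival a s) (rval e s) s)"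
| Seq: "exec P s m s' \<Longrightarrow> exec Q s' m' s'' \<Longrightarrow> exec (Seq P Q) s (m + m') s''"
| IfTrue: "bval b s \<Longrightarrow> exec P s m s' \<Longrightarrow> exec (If b P Q) s (1 + bcost b + m) s'"
| IfFalse: "\<not> bval b s \<Longrightarrow> exec Q s m s' \<Longrightarrow> exec (If b P Q) s (1 + bcost b + m) s'"
| WhileFalse: "\<not> bval b s \<Longrightarrow> exec (While b P) s (1 + bcost b) s"
| WhileTrue: "bval b s \<Longrightarrow> exec P s m s' \<Longrightarrow> exec (While b P) s' m' s'' \<Longrightarrow>
    exec (While b P) s (1 + bcost b + m + m') s''"

inductive_cases SkipE: "exec Skip s m s'"
inductive_cases IWriteE: "exec (IWrite x a e) s m s'"
inductive_cases RWriteE: "exec (RWrite x a e) s m s'"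
inductive_cases SeqE: "exec (Seq P Q) s m s'"
inductive_cases IfE: "exec (If b P Q) s m s'"
inductive_cases WhileE: "exec (While b P) s m s'"

lemma exec_deterministic:
  "exec P s m s' \<Longrightarrow> exec P s m' s'' \<Longrightarrow> m' = m \<and> s'' = s'"
proof (induction arbitrary: m' s'' rule: exec.induct)
  case (Skip s)
  then show ?case by (rule SkipE) simp
next
  case (IWrite x a e s)
  then show ?case by (rule IWriteE) simp
next
  case (RWrite x a e s)
  then show ?case by (rule RWriteE) simp
next
  case (Seq P s m\<^sub>1 s\<^sub>1 Q m\<^sub>2 s\<^sub>2)
  from Seq.prems show ?case
    by (rule SeqE) (auto dest!: Seq.IH)
next
  case (IfTrue b s P m\<^sub>1 s\<^sub>1 Q)
  from IfTrue.prems show ?case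
    by (rule IfE) (auto simp: IfTrue.hyps dest!: IfTrue.IH)
next
  case (IfFalse b s Q m\<^sub>1 s\<^sub>1 P)
  from IfFalse.prems show ?case
    by (rule IfE) (auto simp: IfFalse.hyps dest!: IfFalse.IH)
next
  case (WhileFalse b s P)
  from WhileFalse.prems show ?case
    by (rule WhileE) (simp_all add: WhileFalse.hyps)
next
  case (WhileTrue b s P m\<^sub>1 s\<^sub>1 m\<^sub>2 s\<^sub>2)
  from WhileTrue.prems show ?case
    by (rule WhileE) (auto simp: WhileTrue.hyps dest!: WhileTrue.IH)
qed


section \<open>Input and output\<close>

text \<open>The matrix of coordinates is stored row by row; all memory not holding input is zero.\<close>

definition input_state :: "nat \<Rightarrow> real vec list \<Rightarrow> nat list \<Rightarrow> int \<Rightarrow> state" where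
  "input_state d D \<pi> k =
     \<lparr>imem = (\<lambda>x a.
        if x = ''n'' \<and> a = 0 then int (length D)
        else if x = ''d'' \<and> a = 0 then int d
        else if x = ''k'' \<and> a = 0 then k
        else if x = ''pi'' \<and> 0 \<le> a \<and> a < int (length D) then int (\<pi> ! nat a)
        else 0),
      rmem = (\<lambda>x a.
        if x = ''D'' \<and> 0 \<le> a \<and> a < int (length D * d) then D ! (nat a div d) $ (nat a mod d)
        else 0)\<rparr>"

definition output_weights :: "nat \<Rightarrow> state \<Rightarrow> real vec" where
  "output_weights d s = vec d (\<lambda>j. rmem s ''w'' (int j))"

definition output_bonuses :: "nat \<Rightarrow> state \<Rightarrow> real vec" where
  "output_bonuses n s = vec n (\<lambda>i. rmem s ''v'' (int i))"

end

theory Submission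
  imports Defs
begin

text \<open>
  A weight vector matters only through the pairs of unmodified tuples that it orders strictly, so one
  may ask for score differences at least 1. The polyhedron of all such weights has a minimal face, cut
  out by at most \<open>d\<close> linearly independent equations \<open>(t\<^sub>p - t\<^sub>q) \<cdot> w = 1\<close>, and every point of that
  face orders all these pairs correctly. Hence it suffices to try the \<open>n\<^sup>2\<^sup>d\<close> ways of choosing \<open>d\<close> pairs
  of tuples (a pair \<open>p = q\<close> gives a zero row, which pads shorter systems) and to solve each system by
  Gram-Schmidt orthogonalisation. For a fixed weight vector, the largest set of tuples that can keep
  bonus 0 is a longest strictly decreasing subsequence of the scores along \<open>\<pi>\<close>. Patience sorting finds
  it in time \<open>O(n log n)\<close>, where the binary search uses precomputed powers of two because the machine
  cannot halve integers.
\<close>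

section \<open>Gram-Schmidt and minimal faces\<close>

text \<open>On a minimal face the tight constraints span all others, so every product with a
  constraint is constant there; hence any solution of the chosen equations can replace the point by
  which the face was found. Many enumerated systems are inconsistent. The solver still returns some
  vector for them, which does no harm, since a candidate is judged only by the subsequence that its
  scores admit. A strictly decreasing subsequence of length at least n - k is always enough: between
  two consecutive scores of the chain the reals have room for any number of adjusted scores, and
  each tuple off the chain costs at most one bonus. Orthogonalisation fits the machine because with
  \<open>x / 0 = 0\<close> dependent rows drop out of the formulas by themselves, without pivoting
  or a rank test; the program computes the very recursion that the proof reasons about. The program
  never decides solvability: it writes output whenever a candidate needs at most k bonuses, and each
  such output is a solution.\<close>

definition dot :: "nat \<Rightarrow> (nat \<Rightarrow> real) \<Rightarrow> (nat \<Rightarrow> real) \<Rightarrow> real" where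
  "dot d x y = (\<Sum>j<d. x j * y j)"

lemma dot_cong: "(\<And>j. j < d \<Longrightarrow> x j = x' j) \<Longrightarrow> (\<And>j. j < d \<Longrightarrow> y j = y' j) \<Longrightarrow>
    dot d x y = dot d x' y'"
  by (simp add: dot_def)

lemma dot_commute: "dot d x y = dot d y x"
  by (simp add: dot_def mult.commute)

lemma dot_diff_left: "dot d (\<lambda>j. x j - y j) z = dot d x z - dot d y z"
  by (simp add: dot_def left_diff_distrib sum_subtractf)

lemma dot_diff_right: "dot d z (\<lambda>j. x j - y j) = dot d z x - dot d z y"
  by (simp add: dot_def right_diff_distrib sum_subtractf)

lemma dot_add_right: "dot d z (\<lambda>j. x j + y j) = dot d z x + dot d z y"
  by (simp add: dot_def distrib_left sum.distrib)

lemma dot_scale_right: "dot d z (\<lambda>j. c * x j) = c * dot d z x"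
  by (simp add: dot_def sum_distrib_left algebra_simps)

lemma dot_sum_left: "dot d (\<lambda>j. \<Sum>i\<in>A. c i * x i j) z = (\<Sum>i\<in>A. c i * dot d (x i) z)"
proof -
  have "dot d (\<lambda>j. \<Sum>i\<in>A. c i * x i j) z = (\<Sum>j<d. \<Sum>i\<in>A. c i * (x i j * z j))"
    by (simp add: dot_def sum_distrib_right mult.assoc)
  also have "\<dots> = (\<Sum>i\<in>A. \<Sum>j<d. c i * (x i j * z j))"
    by (rule sum.swap)
  finally show ?thesis
    by (simp add: dot_def sum_distrib_left)
qed

lemma dot_self_ge_0: "0 \<le> dot d x x"
  by (simp add: dot_def sum_nonneg)

text \<open>A vector of norm 0 vanishes on the first d coordinates. This makes the convention
  \<open>x / 0 = 0\<close> agree with dropping the vector from a projection.\<close>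

lemma dot_self_eq_0: "dot d x x = 0 \<Longrightarrow> dot d x y = 0"
  by (simp add: dot_def sum_nonneg_eq_0_iff)

text \<open>Residuals are left unnormalised: unit vectors would need square roots, which the machine
  does not offer.\<close>

fun gram_schmidt :: "nat \<Rightarrow> (nat \<Rightarrow> nat \<Rightarrow> real) \<Rightarrow> nat \<Rightarrow> nat \<Rightarrow> real" where
  "gram_schmidt d a r = (\<lambda>j. a r j -
     (\<Sum>i<r. dot d (a r) (gram_schmidt d a i) / dot d (gram_schmidt d a i) (gram_schmidt d a i)
        * gram_schmidt d a i j))"

declare gram_schmidt.simps [simp del]

text \<open>A row that depends on its predecessors has residual zero; since division by zero yields
  zero, it is skipped.\<close>

primrec solve_ones :: "nat \<Rightarrow> (nat \<Rightarrow> nat \<Rightarrow> real) \<Rightarrow> nat \<Rightarrow> nat \<Rightarrow> real" where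
  "solve_ones d a 0 = (\<lambda>j. 0)"
| "solve_ones d a (Suc r) = (\<lambda>j. solve_ones d a r j +
     (1 - dot d (a r) (solve_ones d a r)) / dot d (gram_schmidt d a r) (gram_schmidt d a r)
       * gram_schmidt d a r j)"

text \<open>Used to test a vector s for dependence: \<open>a(m := s)\<close> appends it as row m and
  leaves the earlier residuals as they are.\<close>

lemma gram_schmidt_cong:
  assumes "\<And>i. i \<le> r \<Longrightarrow> a i = b i"
  shows "gram_schmidt d a r = gram_schmidt d b r"
  using assms
proof (induction r rule: less_induct)
  case (less r)
  have "gram_schmidt d a i = gram_schmidt d b i" if "i < r" for i
    using less that by simp
  then show ?case
    using less.prems by (simp add: gram_schmidt.simps[of d _ r])
qed

lemma solve_ones_cong:
  "(\<And>i. i < r \<Longrightarrow> a i = b i) \<Longrightarrow> solve_ones d a r = solve_ones d b r"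
proof (induction r)
  case (Suc r)
  have "gram_schmidt d a r = gram_schmidt d b r"
    using Suc.prems by (intro gram_schmidt_cong) simp
  with Suc show ?case by simp
qed simp

lemma dot_row_expand:
  "dot d (a r) z = dot d (gram_schmidt d a r) z +
     (\<Sum>i<r. dot d (a r) (gram_schmidt d a i) / dot d (gram_schmidt d a i) (gram_schmidt d a i)
        * dot d (gram_schmidt d a i) z)"
  by (simp add: gram_schmidt.simps[of d a r] dot_diff_left dot_sum_left
      del: times_divide_eq_left times_divide_eq_right)

lemma gram_schmidt_orthogonal:
  "i < r \<Longrightarrow> dot d (gram_schmidt d a r) (gram_schmidt d a i) = 0"
proof (induction r arbitrary: i rule: less_induct)
  case (less r)
  let ?g = "gram_schmidt d a"
  have "dot d (?g l) (?g i) = 0" if "l < r" "l \<noteq> i" for l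
    using less.IH[of l i] less.IH[of i l] less.prems that
    by (metis dot_commute linorder_neqE_nat)
  then have "(\<Sum>l<r. dot d (a r) (?g l) / dot d (?g l) (?g l) * dot d (?g l) (?g i)) =
      (\<Sum>l<r. if l = i then dot d (a r) (?g i) / dot d (?g i) (?g i) * dot d (?g i) (?g i) else 0)"
    by (intro sum.cong) auto
  \<comment> \<open>Cancelling the squared norm of \<open>?g i\<close> is possible unless it is 0,
    and then the right-hand side is 0 as well.\<close>
  also have "\<dots> = dot d (a r) (?g i)"
    using less.prems dot_self_eq_0[of d "?g i" "a r"] by (auto simp: dot_commute)
  finally show ?case
    using dot_row_expand[of d a r "?g i"] by simp
qed

lemma gram_schmidt_orthogonal':
  "i < r \<Longrightarrow> dot d (gram_schmidt d a i) (gram_schmidt d a r) = 0"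
  by (simp add: gram_schmidt_orthogonal dot_commute[of d "gram_schmidt d a i"])

lemma dot_row_residual: "dot d (a r) (gram_schmidt d a r) = dot d (gram_schmidt d a r) (gram_schmidt d a r)"
  using dot_row_expand[of d a r "gram_schmidt d a r"]
  by (simp add: gram_schmidt_orthogonal')

text \<open>Row i lies in the span of the residuals up to i. Hence moving a point along residual r
  keeps the equations of all earlier rows.\<close>

lemma dot_row_later: "i < r \<Longrightarrow> dot d (a i) (gram_schmidt d a r) = 0"
  using dot_row_expand[of d a i "gram_schmidt d a r"]
  by (simp add: gram_schmidt_orthogonal')

text \<open>The other inclusion of spans: residual r is a combination of the rows up to r.\<close>

lemma dot_gram_schmidt_eq_0:
  "(\<And>i. i \<le> r \<Longrightarrow> dot d (a i) z = 0) \<Longrightarrow> dot d (gram_schmidt d a r) z = 0"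
proof (induction r rule: less_induct)
  case (less r)
  then show ?case
    using dot_row_expand[of d a r z] by simp
qed

text \<open>Step i moves along residual i just far enough to give row i the product 1, and all later
  moves are orthogonal to row i.\<close>

lemma solve_ones_row:
  assumes "i < m" "dot d (gram_schmidt d a i) (gram_schmidt d a i) \<noteq> 0"
  shows "dot d (a i) (solve_ones d a m) = 1"
  using assms(1)
proof (induction m)
  case (Suc m)
  show ?case
  proof (cases "i = m")
    case True
    then show ?thesis
      using assms(2) dot_scale_right[of d "a m" "(1 - dot d (a m) (solve_ones d a m)) /
          dot d (gram_schmidt d a m) (gram_schmidt d a m)"]
      by (simp only: solve_ones.simps dot_add_right dot_row_residual) simp
  next
    case False
    then show ?thesis
      using Suc
      by (simp add: dot_add_right dot_scale_right dot_row_later del: times_divide_eq_left)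
  qed
qed simp

text \<open>Bessel's inequality for the unit vectors, summed over all coordinates.\<close>

lemma gram_schmidt_length_le:
  assumes "\<And>i. i < m \<Longrightarrow> dot d (gram_schmidt d a i) (gram_schmidt d a i) \<noteq> 0"
  shows "m \<le> d"
proof -
  let ?g = "gram_schmidt d a"
  have bessel: "(\<Sum>i<m. ?g i j * ?g i j / dot d (?g i) (?g i)) \<le> 1" if "j < d" for j
  proof -
    define e where "e = (\<lambda>l. if l = j then 1 else 0 :: real)"
    \<comment> \<open>The unit vector is appended as row m. Its product with its own residual is a
      squared norm, and expanding that product gives 1 minus the Bessel sum.\<close>
    define b where "b = a(m := e)"
    have dot_e: "dot d e z = z j" for z
    proof -
      have "dot d e z = (\<Sum>l<d. if l = j then z l else 0)"
        unfolding dot_def e_def by (intro sum.cong) auto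
      then show ?thesis
        using that by simp
    qed
    have g: "gram_schmidt d b i = ?g i" if "i < m" for i
      using that by (intro gram_schmidt_cong) (simp add: b_def)
    have "0 \<le> dot d (b m) (gram_schmidt d b m)"
      by (simp add: dot_row_residual dot_self_ge_0)
    also have "\<dots> = gram_schmidt d b m j"
      by (simp add: b_def dot_e)
    also have "\<dots> = 1 - (\<Sum>i<m. ?g i j / dot d (?g i) (?g i) * ?g i j)"
      using g by (subst gram_schmidt.simps) (simp add: b_def dot_e, simp add: e_def)
    finally show ?thesis
      by simp
  qed
  \<comment> \<open>Double counting: each nonzero residual contributes 1 to the total, and each
    coordinate receives at most 1.\<close>
  have "real m = (\<Sum>i<m. dot d (?g i) (?g i) / dot d (?g i) (?g i))"
    using assms by simp
  also have "\<dots> = (\<Sum>i<m. \<Sum>j<d. ?g i j * ?g i j / dot d (?g i) (?g i))"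
    by (subst (1) dot_def) (simp add: sum_divide_distrib)
  also have "\<dots> = (\<Sum>j<d. \<Sum>i<m. ?g i j * ?g i j / dot d (?g i) (?g i))"
    by (rule sum.swap)
  also have "\<dots> \<le> (\<Sum>j<d. 1)"
    using bessel by (intro sum_mono) simp
  finally show ?thesis by simp
qed

text \<open>This is the existence of a minimal face of the polyhedron of all \<open>u\<close> with
  \<open>s \<cdot> u \<ge> 1\<close> for \<open>s \<in> S\<close>: as long as some constraint is independent of the tight ones, moving
  \<open>u\<close> against its residual makes one more independent constraint tight.\<close>

lemma ex_rows_solve_ones_pos:
  assumes fin: "finite S" and pos: "\<And>s. s \<in> S \<Longrightarrow> 0 < dot d s w"
  shows "\<exists>a. (\<forall>i<d. a i \<in> S \<or> a i = (\<lambda>j. 0)) \<and> (\<forall>s\<in>S. 0 < dot d s (solve_ones d a d))"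
proof -
  define tight where "tight m \<longleftrightarrow> (\<exists>a u. (\<forall>i<m. a i \<in> S \<and>
      dot d (gram_schmidt d a i) (gram_schmidt d a i) \<noteq> 0 \<and> dot d (a i) u = 1) \<and>
      (\<forall>s\<in>S. 1 \<le> dot d s u))" for m
  have "tight 0"
  proof (cases "S = {}")
    case True
    then show ?thesis by (simp add: tight_def)
  next
    case False
    \<comment> \<open>The least product over the finite set \<open>S\<close>; dividing w by it turns
      positive products into products at least 1.\<close>
    define c where "c = Min ((\<lambda>s. dot d s w) ` S)"
    have c: "0 < c" "\<And>s. s \<in> S \<Longrightarrow> c \<le> dot d s w"
      using fin False pos by (auto simp: c_def)
    have "1 \<le> dot d s (\<lambda>j. 1 / c * w j)" if "s \<in> S" for s
      using c that by (simp only: dot_scale_right) (simp add: field_simps)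
    then show ?thesis
      unfolding tight_def by blast
  qed
  moreover have le: "m \<le> d" if "tight m" for m
    using that gram_schmidt_length_le unfolding tight_def by blast
  \<comment> \<open>\<open>tight\<close> holds at 0 and fails at \<open>Suc d\<close>, so there is a
    last number before its first failure.\<close>
  ultimately have "\<exists>m. tight m \<and> \<not> tight (Suc m)"
    using nat_induct[of tight "Suc d"] not_less_eq_eq[of d d] by blast
  then obtain m where "tight m" and max: "\<not> tight (Suc m)"
    by blast
  from \<open>tight m\<close> obtain a u where a: "\<And>i. i < m \<Longrightarrow> a i \<in> S"
      "\<And>i. i < m \<Longrightarrow> dot d (gram_schmidt d a i) (gram_schmidt d a i) \<noteq> 0"
      "\<And>i. i < m \<Longrightarrow> dot d (a i) u = 1"
    and u: "\<And>s. s \<in> S \<Longrightarrow> 1 \<le> dot d s u"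
    unfolding tight_def by blast
  have dependent: "dot d (gram_schmidt d (a(m := s)) m) (gram_schmidt d (a(m := s)) m) = 0"
    if s: "s \<in> S" for s
  proof (rule ccontr)
    define z where "z = gram_schmidt d (a(m := s)) m"
    assume "dot d (gram_schmidt d (a(m := s)) m) (gram_schmidt d (a(m := s)) m) \<noteq> 0"
    then have "dot d z z > 0"
      using dot_self_ge_0[of d z] by (simp add: z_def)
    moreover have "dot d s z = dot d z z"
      using dot_row_residual[of d "a(m := s)" m] by (simp add: z_def)
    ultimately have "{s \<in> S. 0 < dot d s z} \<noteq> {}"
      using s by auto
    \<comment> \<open>Ratio test as in the simplex method: t is the constraint that becomes tight
      first when u moves along -z.\<close>
    then obtain t where "is_arg_min (\<lambda>s. (dot d s u - 1) / dot d s z)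
        (\<lambda>s. s \<in> {s \<in> S. 0 < dot d s z}) t"
      using fin ex_is_arg_min_if_finite[of "{s \<in> S. 0 < dot d s z}"] by fastforce
    then have t: "t \<in> S" "0 < dot d t z"
      and t_min: "\<And>s. s \<in> S \<Longrightarrow> 0 < dot d s z \<Longrightarrow>
        (dot d t u - 1) / dot d t z \<le> (dot d s u - 1) / dot d s z"
      by (auto simp: is_arg_min_linorder)
    define c where "c = (dot d t u - 1) / dot d t z"
    define u' where "u' = (\<lambda>j. u j - c * z j)"
    have dot_u': "dot d x u' = dot d x u - c * dot d x z" for x
      by (simp add: u'_def dot_diff_right dot_scale_right)
    have c: "0 \<le> c"
      using t u by (simp add: c_def)
    have u'_ge: "1 \<le> dot d x u'" if "x \<in> S" for x
    proof (cases "0 < dot d x z")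
      case True
      then show ?thesis
        using t_min[OF that True] by (simp add: dot_u' c_def[symmetric] pos_le_divide_eq)
    next
      case False
      then have "c * dot d x z \<le> 0"
        using c by (simp add: mult_nonneg_nonpos)
      then show ?thesis
        using u[OF that] by (simp add: dot_u')
    qed
    have z_orth: "dot d (a i) z = 0" if "i < m" for i
      using dot_row_later[of i m d "a(m := s)"] that by (simp add: z_def)
    have g: "gram_schmidt d (a(m := t)) i = gram_schmidt d a i" if "i < m" for i
      using that by (intro gram_schmidt_cong) simp
    \<comment> \<open>The new tight constraint t may differ from s. It is still independent of the
      old rows, because they are orthogonal to z and t is not.\<close>
    have g_new: "dot d (gram_schmidt d (a(m := t)) m) (gram_schmidt d (a(m := t)) m) \<noteq> 0"
    proof
      assume 0: "dot d (gram_schmidt d (a(m := t)) m) (gram_schmidt d (a(m := t)) m) = 0"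
      have "dot d (gram_schmidt d a i) z = 0" if "i < m" for i
        using that z_orth by (intro dot_gram_schmidt_eq_0) simp
      then have "dot d t z = dot d (gram_schmidt d (a(m := t)) m) z"
        using dot_row_expand[of d "a(m := t)" m z] by (simp add: g)
      then show False
        using t dot_self_eq_0[OF 0, of z] by simp
    qed
    have "tight (Suc m)"
      unfolding tight_def
    proof (intro exI conjI allI impI ballI)
      show "1 \<le> dot d x u'" if "x \<in> S" for x
        using that by (rule u'_ge)
      show "(a(m := t)) i \<in> S" if "i < Suc m" for i
        using that a t by simp
      show "dot d (gram_schmidt d (a(m := t)) i) (gram_schmidt d (a(m := t)) i) \<noteq> 0"
        if "i < Suc m" for i
        using that a g g_new by (cases "i = m") auto
      show "dot d ((a(m := t)) i) u' = 1" if "i < Suc m" for i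
        using that a t z_orth by (simp add: dot_u' c_def)
    qed
    then show False
      using max by simp
  qed
  define b where "b i = (if i < m then a i else (\<lambda>j. 0))" for i
  have "m \<le> d"
    using \<open>tight m\<close> by (rule le)
  have "0 < dot d s (solve_ones d b d)" if s: "s \<in> S" for s
  proof -
    \<comment> \<open>The computed point and u agree on the tight rows, hence on everything that
      depends on them, which is all of \<open>S\<close>. So the positive products of u carry
      over.\<close>
    define y where "y = (\<lambda>j. solve_ones d b d j - u j)"
    have "dot d (a i) y = 0" if "i < m" for i
    proof -
      have "gram_schmidt d b i = gram_schmidt d a i"
        using that by (intro gram_schmidt_cong) (simp add: b_def)
      then have "dot d (b i) (solve_ones d b d) = 1"
        using a that \<open>m \<le> d\<close> by (intro solve_ones_row) auto
      then show ?thesis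
        using that a by (simp add: b_def y_def dot_diff_right)
    qed
    then have "dot d (gram_schmidt d a i) y = 0" if "i < m" for i
      using that by (intro dot_gram_schmidt_eq_0) simp
    moreover have "gram_schmidt d (a(m := s)) i = gram_schmidt d a i" if "i < m" for i
      using that by (intro gram_schmidt_cong) simp
    ultimately have "dot d s y = 0"
      using dot_row_expand[of d "a(m := s)" m y] dot_self_eq_0[OF dependent[OF s], of y] by simp
    then show ?thesis
      using u[OF s] by (simp add: y_def dot_diff_right)
  qed
  moreover have "b i \<in> S \<or> b i = (\<lambda>j. 0)" for i
    using a by (simp add: b_def)
  ultimately show ?thesis
    by blast
qed

section \<open>Weakest preconditions with running time\<close>

text \<open>Termination is included, and executions are deterministic, so one suitable run describes
  all behaviour. Passing the cost to the postcondition lets time and correctness be proved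
  together.\<close>

definition wp :: "com \<Rightarrow> (nat \<Rightarrow> state \<Rightarrow> bool) \<Rightarrow> state \<Rightarrow> bool" where
  "wp c Q s \<longleftrightarrow> (\<exists>m s'. exec c s m s' \<and> Q m s')"

lemma wp_Skip [simp]: "wp Skip Q = Q 1"
  unfolding wp_def fun_eq_iff by (metis exec.Skip SkipE)

lemma wp_IWrite [simp]:
  "wp (IWrite x a e) Q = (\<lambda>s. Q (1 + icost a + icost e) (iupdate x (ival a s) (ival e s) s))"
  unfolding wp_def fun_eq_iff by (metis exec.IWrite IWriteE)

lemma wp_RWrite [simp]:
  "wp (RWrite x a e) Q = (\<lambda>s. Q (1 + icost a + rcost e) (rupdate x (ival a s) (rval e s) s))"
  unfolding wp_def fun_eq_iff by (metis exec.RWrite RWriteE)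

lemma wp_Seq [simp]: "wp (Seq c c') Q = wp c (\<lambda>m. wp c' (\<lambda>m'. Q (m + m')))"
  unfolding wp_def fun_eq_iff by (blast intro: exec.Seq elim: SeqE)

lemma wp_If [simp]:
  "wp (If b c c') Q = (\<lambda>s.
     if bval b s then wp c (\<lambda>m. Q (1 + bcost b + m)) s else wp c' (\<lambda>m. Q (1 + bcost b + m)) s)"
proof
  fix s
  show "wp (If b c c') Q s = (if bval b s then wp c (\<lambda>m. Q (1 + bcost b + m)) s
      else wp c' (\<lambda>m. Q (1 + bcost b + m)) s)"
  proof (cases "bval b s")
    case True
    then show ?thesis
      unfolding wp_def if_P[OF True] by (intro iffI) (auto elim!: IfE, metis exec.IfTrue plus_1_eq_Suc add_Suc)
  next
    case False
    then show ?thesis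
      unfolding wp_def if_not_P[OF False] by (intro iffI) (auto elim!: IfE, metis exec.IfFalse plus_1_eq_Suc add_Suc)
  qed
qed

lemma wp_WhileTrue:
  "bval b s \<Longrightarrow> wp c (\<lambda>m. wp (While b c) (\<lambda>m'. Q (1 + bcost b + m + m'))) s \<Longrightarrow>
     wp (While b c) Q s"
  unfolding wp_def by (blast intro: exec.intros)

lemma wp_WhileFalse: "\<not> bval b s \<Longrightarrow> Q (1 + bcost b) s \<Longrightarrow> wp (While b c) Q s"
  unfolding wp_def by (blast intro: exec.intros)

lemma imem_iupdate [simp]: "imem (iupdate x i z s) = (imem s)(x := (imem s x)(i := z))"
  and rmem_iupdate [simp]: "rmem (iupdate x i z s) = rmem s"
  and imem_rupdate [simp]: "imem (rupdate x i y s) = imem s"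
  and rmem_rupdate [simp]: "rmem (rupdate x i y s) = (rmem s)(x := (rmem s x)(i := y))"
  by (simp_all add: iupdate_def rupdate_def)

section \<open>Frame property: the arrays a program may change\<close>

primrec iwrites :: "com \<Rightarrow> string set" where
  "iwrites Skip = {}"
| "iwrites (IWrite x a e) = {x}"
| "iwrites (RWrite x a e) = {}"
| "iwrites (Seq c c') = iwrites c \<union> iwrites c'"
| "iwrites (If b c c') = iwrites c \<union> iwrites c'"
| "iwrites (While b c) = iwrites c"

primrec rwrites :: "com \<Rightarrow> string set" where
  "rwrites Skip = {}"
| "rwrites (IWrite x a e) = {}"
| "rwrites (RWrite x a e) = {x}"
| "rwrites (Seq c c') = rwrites c \<union> rwrites c'"
| "rwrites (If b c c') = rwrites c \<union> rwrites c'"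
| "rwrites (While b c) = rwrites c"

definition same :: "string set \<Rightarrow> string set \<Rightarrow> state \<Rightarrow> state \<Rightarrow> bool" where
  "same W R s s' \<longleftrightarrow> (\<forall>x. x \<notin> W \<longrightarrow> imem s' x = imem s x) \<and> (\<forall>x. x \<notin> R \<longrightarrow> rmem s' x = rmem s x)"

lemma exec_same: "exec c s m s' \<Longrightarrow> same (iwrites c) (rwrites c) s s'"
  by (induction rule: exec.induct) (auto simp: same_def)

lemma wp_frame:
  assumes "wp c Q s" "\<And>m s'. same (iwrites c) (rwrites c) s s' \<Longrightarrow> Q m s' \<Longrightarrow> Q' m s'"
  shows "wp c Q' s"
  using assms exec_same unfolding wp_def by blast

text \<open>Turns a specification into a concrete final state, so that straight-line code can be
  followed state by state; \<open>wp_exec\<close> leads back.\<close>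

lemma wpE:
  assumes "wp c Q s"
  obtains m s' where "exec c s m s'" "same (iwrites c) (rwrites c) s s'" "Q m s'"
  using assms exec_same unfolding wp_def by blast

lemma wp_exec: "exec c s m s' \<Longrightarrow> Q m s' \<Longrightarrow> wp c Q s"
  unfolding wp_def by blast

text \<open>The counter k in \<open>J\<close> fixes the number N - k of remaining rounds, which
  yields termination and the time bound at once. The last \<open>1 + bcost b\<close> pays for the
  failing test.\<close>

lemma wp_While_count:
  assumes "\<And>k s. k < N \<Longrightarrow> J k s \<Longrightarrow> bval b s \<and> wp c (\<lambda>m s'. m \<le> t \<and> J (Suc k) s') s"
    and "\<And>s. J N s \<Longrightarrow> \<not> bval b s" and "k \<le> N" and "J k s"
  shows "wp (While b c) (\<lambda>m s'. m \<le> (N - k) * (t + 1 + bcost b) + 1 + bcost b \<and> J N s') s"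
  using assms(3,4)
proof (induction "N - k" arbitrary: k s)
  case 0
  then show ?case
    using assms(2) by (intro wp_WhileFalse) auto
next
  case (Suc r)
  then have k: "k < N" "r = N - Suc k"
    by auto
  have "wp c (\<lambda>m. wp (While b c) (\<lambda>m' s'.
      1 + bcost b + m + m' \<le> (N - k) * (t + 1 + bcost b) + 1 + bcost b \<and> J N s')) s"
  proof (rule wp_frame)
    show "wp c (\<lambda>m s'. m \<le> t \<and> J (Suc k) s') s"
      using assms(1) k Suc.prems by blast
  next
    fix m s' assume m: "m \<le> t \<and> J (Suc k) s'"
    have "N - k = Suc (N - Suc k)"
      using k by simp
    with m k show "wp (While b c) (\<lambda>m' s'.
        1 + bcost b + m + m' \<le> (N - k) * (t + 1 + bcost b) + 1 + bcost b \<and> J N s') s'"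
      by (intro wp_frame[OF Suc.hyps(1)[of "Suc k" s']]) (auto simp: Suc_leI)
  qed
  then show ?case
    using assms(1) k Suc.prems by (intro wp_WhileTrue) auto
qed

section \<open>Counted loops\<close>

abbreviation ivar :: "string \<Rightarrow> iexp" where
  "ivar x \<equiv> IRead x (IConst 0)"

abbreviation rvar :: "string \<Rightarrow> rexp" where
  "rvar x \<equiv> RRead x (IConst 0)"

abbreviation iset :: "string \<Rightarrow> iexp \<Rightarrow> com" where
  "iset x e \<equiv> IWrite x (IConst 0) e"

abbreviation rset :: "string \<Rightarrow> rexp \<Rightarrow> com" where
  "rset x e \<equiv> RWrite x (IConst 0) e"

notation Seq (infixr ";;" 60)

definition for_loop :: "string \<Rightarrow> iexp \<Rightarrow> com \<Rightarrow> com" where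
  "for_loop i e c =
     iset i (IConst 0);; While (ILess (ivar i) e) (c;; iset i (IAdd (ivar i) (IConst 1)))"

lemma iwrites_for_loop [simp]: "iwrites (for_loop i e c) = insert i (iwrites c)"
  and rwrites_for_loop [simp]: "rwrites (for_loop i e c) = rwrites c"
  by (auto simp: for_loop_def)

text \<open>The initialisation costs 3, each guard test \<open>4 + icost e\<close> and each
  increment 6; hence 7 outside and 10 inside the product. The third premise keeps the invariant
  independent of the loop variable, whose value the body gets separately.\<close>

lemma wp_for_loop:
  assumes e: "\<And>s'. same (insert i (iwrites c)) (rwrites c) s s' \<Longrightarrow> ival e s' = int N"
    and i: "i \<notin> iwrites c"
    and stable: "\<And>k s' z. I k s' \<Longrightarrow> I k (iupdate i 0 z s')"
    and init: "I 0 s"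
    and step: "\<And>k s'. k < N \<Longrightarrow> same (insert i (iwrites c)) (rwrites c) s s' \<Longrightarrow>
      imem s' i 0 = int k \<Longrightarrow> I k s' \<Longrightarrow> wp c (\<lambda>m s''. m \<le> t \<and> I (Suc k) s'') s'"
  shows "wp (for_loop i e c) (\<lambda>m s'. m \<le> icost e + 7 + N * (t + icost e + 10) \<and> I N s') s"
proof -
  define J where "J k s' \<longleftrightarrow> same (insert i (iwrites c)) (rwrites c) s s' \<and> imem s' i 0 = int k \<and> I k s'"
    for k s'
  let ?b = "ILess (ivar i) e"
  let ?c = "c;; iset i (IAdd (ivar i) (IConst 1))"
  have "bval ?b s' \<and> wp ?c (\<lambda>m s''. m \<le> t + 6 \<and> J (Suc k) s'') s'" if "k < N" "J k s'" for k s'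
  proof
    show "bval ?b s'"
      using that e[of s'] by (simp add: J_def)
    have "wp c (\<lambda>m s''. m \<le> t \<and> I (Suc k) s'') s'"
      using that step by (simp add: J_def)
    then have "wp c (\<lambda>m s''. m + 6 \<le> t + 6 \<and>
        J (Suc k) (iupdate i 0 (imem s'' i 0 + 1) s'')) s'"
    proof (rule wp_frame)
      fix m s'' assume *: "same (iwrites c) (rwrites c) s' s''" "m \<le> t \<and> I (Suc k) s''"
      have "imem s'' i 0 = int k"
        using that *(1) i by (simp add: J_def same_def)
      moreover have "same (insert i (iwrites c)) (rwrites c) s (iupdate i 0 z s'')" for z
        using that *(1) by (auto simp: J_def same_def)
      ultimately show "m + 6 \<le> t + 6 \<and> J (Suc k) (iupdate i 0 (imem s'' i 0 + 1) s'')"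
        using * stable by (simp add: J_def)
    qed
    then show "wp ?c (\<lambda>m s''. m \<le> t + 6 \<and> J (Suc k) s'') s'"
      by simp
  qed
  moreover have "\<not> bval ?b s'" if "J N s'" for s'
    using that e[of s'] by (simp add: J_def)
  moreover have "J 0 (iupdate i 0 0 s)"
    using init stable by (auto simp: J_def same_def)
  ultimately have "wp (While ?b ?c) (\<lambda>m s'. m \<le> (N - 0) * (t + 6 + 1 + bcost ?b) + 1 + bcost ?b \<and> J N s')
      (iupdate i 0 0 s)"
    by (intro wp_While_count) auto
  then have "wp (While ?b ?c) (\<lambda>m s'. 3 + m \<le> icost e + 7 + N * (t + icost e + 10) \<and> I N s')
      (iupdate i 0 0 s)"
    by (rule wp_frame) (auto simp: J_def algebra_simps)
  then show ?thesis
    by (simp add: for_loop_def)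
qed

section \<open>Inner products and scaled additions\<close>

definition dot_prog :: "string \<Rightarrow> iexp \<Rightarrow> string \<Rightarrow> iexp \<Rightarrow> com" where
  "dot_prog x a y b =
     rset ''acc'' (RInt (IConst 0));;
     for_loop ''j'' (ivar ''d'')
       (rset ''acc'' (RAdd (rvar ''acc'')
          (RMul (RRead x (IAdd a (ivar ''j''))) (RRead y (IAdd b (ivar ''j''))))))"

lemma writes_dot_prog [simp]:
  "iwrites (dot_prog x a y b) = {''j''}" "rwrites (dot_prog x a y b) = {''acc''}"
  by (simp_all add: dot_prog_def)

text \<open>The base addresses must keep their values while the loop changes \<open>j\<close> and
  \<open>acc\<close>. A round costs 14 plus the cost of both addresses, so the bound 12 gives 26,
  and with the loop overhead 38.\<close>

lemma wp_dot_prog: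
  assumes "imem s ''d'' 0 = int d" "x \<noteq> ''acc''" "y \<noteq> ''acc''" "icost a + icost b \<le> 12"
    and "\<And>s'. same {''j''} {''acc''} s s' \<Longrightarrow> ival a s' = X"
    and "\<And>s'. same {''j''} {''acc''} s s' \<Longrightarrow> ival b s' = Y"
  shows "wp (dot_prog x a y b) (\<lambda>m s'. m \<le> 13 + d * 38 \<and>
     rmem s' ''acc'' 0 = dot d (\<lambda>j. rmem s x (X + int j)) (\<lambda>j. rmem s y (Y + int j))) s"
proof -
  let ?s = "rupdate ''acc'' 0 0 s"
  let ?c = "rset ''acc'' (RAdd (rvar ''acc'')
          (RMul (RRead x (IAdd a (ivar ''j''))) (RRead y (IAdd b (ivar ''j'')))))"
  have same: "same {''j''} {''acc''} s s'" if "same {''j''} {''acc''} ?s s'" for s'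
    using that by (auto simp: same_def)
  have "wp (for_loop ''j'' (ivar ''d'') ?c) (\<lambda>m s'. m \<le> icost (ivar ''d'') + 7 + d * (26 + icost (ivar ''d'') + 10) \<and>
      rmem s' ''acc'' 0 = dot d (\<lambda>j. rmem s x (X + int j)) (\<lambda>j. rmem s y (Y + int j))) ?s"
  proof (rule wp_for_loop)
    fix k s' assume "same (insert ''j'' (iwrites ?c)) (rwrites ?c) ?s s'" "imem s' ''j'' 0 = int k"
      "rmem s' ''acc'' 0 = dot k (\<lambda>j. rmem s x (X + int j)) (\<lambda>j. rmem s y (Y + int j))"
    then show "wp ?c (\<lambda>m s''. m \<le> 26 \<and> rmem s'' ''acc'' 0 =
        dot (Suc k) (\<lambda>j. rmem s x (X + int j)) (\<lambda>j. rmem s y (Y + int j))) s'"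
      using assms same[of s'] by (simp add: same_def dot_def)
  qed (use assms in \<open>auto simp: same_def dot_def\<close>)
  then have "wp (for_loop ''j'' (ivar ''d'') ?c) (\<lambda>m s'. 4 + m \<le> 13 + d * 38 \<and>
      rmem s' ''acc'' 0 = dot d (\<lambda>j. rmem s x (X + int j)) (\<lambda>j. rmem s y (Y + int j))) ?s"
    by (rule wp_frame) auto
  then show ?thesis
    by (simp add: dot_prog_def)
qed

text \<open>The factor is passed in \<open>acc\<close>; a caller that wants to subtract negates it
  first.\<close>

definition axpy_prog :: "string \<Rightarrow> string \<Rightarrow> iexp \<Rightarrow> com" where
  "axpy_prog y x a =
     for_loop ''j'' (ivar ''d'')
       (RWrite y (ivar ''j'')
          (RAdd (RRead y (ivar ''j'')) (RMul (rvar ''acc'') (RRead x (IAdd a (ivar ''j''))))))"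

lemma writes_axpy_prog [simp]:
  "iwrites (axpy_prog y x a) = {''j''}" "rwrites (axpy_prog y x a) = {y}"
  by (simp_all add: axpy_prog_def)

lemma wp_axpy_prog:
  assumes "imem s ''d'' 0 = int d" "x \<noteq> y" "y \<noteq> ''acc''" "icost a \<le> 6"
    and "\<And>s'. same {''j''} {y} s s' \<Longrightarrow> ival a s' = X"
  shows "wp (axpy_prog y x a) (\<lambda>m s'. m \<le> 9 + d * 32 \<and>
     (\<forall>j<d. rmem s' y (int j) = rmem s y (int j) + rmem s ''acc'' 0 * rmem s x (X + int j))) s"
proof -
  let ?c = "RWrite y (ivar ''j'')
      (RAdd (RRead y (ivar ''j'')) (RMul (rvar ''acc'') (RRead x (IAdd a (ivar ''j'')))))"
  let ?I = "\<lambda>k s'. \<forall>j<d. rmem s' y (int j) =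
      (if j < k then rmem s y (int j) + rmem s ''acc'' 0 * rmem s x (X + int j) else rmem s y (int j))"
  have "wp (for_loop ''j'' (ivar ''d'') ?c)
      (\<lambda>m s'. m \<le> icost (ivar ''d'') + 7 + d * (20 + icost (ivar ''d'') + 10) \<and> ?I d s') s"
  proof (rule wp_for_loop[where I = ?I])
    fix k s' assume "k < d" "same (insert ''j'' (iwrites ?c)) (rwrites ?c) s s'"
      "imem s' ''j'' 0 = int k" "?I k s'"
    then show "wp ?c (\<lambda>m s''. m \<le> 20 \<and> ?I (Suc k) s'') s'"
      using assms by (auto simp: same_def less_Suc_eq)
  qed (use assms in \<open>auto simp: same_def\<close>)
  then show ?thesis
    unfolding axpy_prog_def by (rule wp_frame) auto
qed

section \<open>Solving the linear system\<close>

text \<open>The row is kept twice: \<open>a\<close> stays intact for the inner products, while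
  \<open>z\<close> is reduced to the residual. The coefficients thus refer to the original row,
  exactly as in \<open>gram_schmidt\<close>.\<close>

definition load_prog :: com where
  "load_prog =
     for_loop ''j'' (ivar ''d'')
       (RWrite ''a'' (ivar ''j'')
          (RSub (RRead ''D'' (IAdd (ivar ''row1'') (ivar ''j''))) (RRead ''D'' (IAdd (ivar ''row2'') (ivar ''j''))));;
        RWrite ''z'' (ivar ''j'') (RRead ''a'' (ivar ''j'')))"

definition project_prog :: com where
  "project_prog =
     for_loop ''i'' (ivar ''r'')
       (dot_prog ''a'' (IConst 0) ''b'' (IMul (ivar ''i'') (ivar ''d''));;
        rset ''fac'' (rvar ''acc'');;
        dot_prog ''b'' (IMul (ivar ''i'') (ivar ''d'')) ''b'' (IMul (ivar ''i'') (ivar ''d''));;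
        rset ''acc'' (RSub (RInt (IConst 0)) (RDiv (rvar ''fac'') (rvar ''acc'')));;
        axpy_prog ''z'' ''b'' (IMul (ivar ''i'') (ivar ''d'')))"

definition store_prog :: com where
  "store_prog =
     for_loop ''j'' (ivar ''d'')
       (RWrite ''b'' (IAdd (IMul (ivar ''r'') (ivar ''d'')) (ivar ''j'')) (RRead ''z'' (ivar ''j'')))"

text \<open>Cells 2r and 2r + 1 of \<open>c\<close> hold the pair of tuples whose difference is row
  r; multiplied by d they become addresses in the row-wise stored \<open>D\<close>.\<close>

definition step_prog :: com where
  "step_prog =
     (iset ''row1'' (IMul (IRead ''c'' (IAdd (ivar ''r'') (ivar ''r''))) (ivar ''d''));;
      iset ''row2'' (IMul (IRead ''c'' (IAdd (IAdd (ivar ''r'') (ivar ''r'')) (IConst 1))) (ivar ''d''));;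
      load_prog;;
      project_prog;;
      store_prog;;
      dot_prog ''a'' (IConst 0) ''u'' (IConst 0);;
      rset ''fac'' (RSub (RInt (IConst 1)) (rvar ''acc''));;
      dot_prog ''z'' (IConst 0) ''z'' (IConst 0);;
      rset ''acc'' (RDiv (rvar ''fac'') (rvar ''acc''));;
      axpy_prog ''u'' ''z'' (IConst 0))"

definition solve_prog :: com where
  "solve_prog =
     (for_loop ''j'' (ivar ''d'') (RWrite ''u'' (ivar ''j'') (RInt (IConst 0)));;
      for_loop ''r'' (ivar ''d'') step_prog)"

text \<open>Scores are stored by position in the ranking, not by tuple index, so that
  \<open>x\<close> is the sequence whose decreasing subsequences matter.\<close>

definition score_prog :: com where
  "score_prog =
     for_loop ''p'' (ivar ''n'')
       (dot_prog ''u'' (IConst 0) ''D'' (IMul (IRead ''pi'' (ivar ''p'')) (ivar ''d''));;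
        RWrite ''x'' (ivar ''p'') (rvar ''acc''))"

lemma writes_solve [simp]:
  "iwrites load_prog = {''j''}" "rwrites load_prog = {''a'', ''z''}"
  "iwrites project_prog = {''i'', ''j''}" "rwrites project_prog = {''acc'', ''fac'', ''z''}"
  "iwrites store_prog = {''j''}" "rwrites store_prog = {''b''}"
  "iwrites step_prog = {''row1'', ''row2'', ''i'', ''j''}"
  "rwrites step_prog = {''a'', ''z'', ''acc'', ''fac'', ''b'', ''u''}"
  "iwrites solve_prog = {''r'', ''row1'', ''row2'', ''i'', ''j''}"
  "rwrites solve_prog = {''a'', ''z'', ''acc'', ''fac'', ''b'', ''u''}"
  "iwrites score_prog = {''p'', ''j''}" "rwrites score_prog = {''acc'', ''x''}"
  by (auto simp: load_prog_def project_prog_def store_prog_def step_prog_def solve_prog_def score_prog_def)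

lemma wp_load_prog:
  assumes "imem s ''d'' 0 = int d"
  shows "wp load_prog (\<lambda>m s'. m \<le> 9 + d * 38 \<and> (\<forall>j<d. rmem s' ''a'' (int j) =
      rmem s ''D'' (imem s ''row1'' 0 + int j) - rmem s ''D'' (imem s ''row2'' 0 + int j) \<and>
      rmem s' ''z'' (int j) = rmem s' ''a'' (int j))) s"
  unfolding load_prog_def
  by (rule wp_frame, rule wp_for_loop[where N = d and t = 26 and I = "\<lambda>k s'. \<forall>j<k. rmem s' ''a'' (int j) =
      rmem s ''D'' (imem s ''row1'' 0 + int j) - rmem s ''D'' (imem s ''row2'' 0 + int j) \<and>
      rmem s' ''z'' (int j) = rmem s' ''a'' (int j)"])
    (use assms in \<open>auto simp: same_def less_Suc_eq\<close>)

text \<open>The coefficient 108 is 38 + 38 + 32, for two inner products and one scaled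
  addition.\<close>

lemma wp_project_prog:
  assumes d: "imem s ''d'' 0 = int d" and r: "imem s ''r'' 0 = int r"
    and b: "\<And>i j. i < r \<Longrightarrow> j < d \<Longrightarrow> rmem s ''b'' (int i * int d + int j) = g i j"
    and a: "\<And>j. j < d \<Longrightarrow> rmem s ''a'' (int j) = h j" and z: "\<And>j. j < d \<Longrightarrow> rmem s ''z'' (int j) = h j"
  shows "wp project_prog (\<lambda>m s'. m \<le> 9 + r * (70 + d * 108) \<and> (\<forall>j<d. rmem s' ''z'' (int j) =
      h j - (\<Sum>i<r. dot d h (g i) / dot d (g i) (g i) * g i j))) s"
proof -
  let ?id = "IMul (ivar ''i'') (ivar ''d'')"
  let ?c = "dot_prog ''a'' (IConst 0) ''b'' ?id;; rset ''fac'' (rvar ''acc'');;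
        dot_prog ''b'' ?id ''b'' ?id;;
        rset ''acc'' (RSub (RInt (IConst 0)) (RDiv (rvar ''fac'') (rvar ''acc'')));;
        axpy_prog ''z'' ''b'' ?id"
  let ?I = "\<lambda>k s'. \<forall>j<d. rmem s' ''z'' (int j) =
      h j - (\<Sum>i<k. dot d h (g i) / dot d (g i) (g i) * g i j)"
  have step: "wp ?c (\<lambda>m s''. m \<le> d * 108 + 58 \<and> ?I (Suc k) s'') s0"
    if k: "k < r" and same0: "same (insert ''i'' (iwrites ?c)) (rwrites ?c) s s0"
      and i0: "imem s0 ''i'' 0 = int k" and z0: "?I k s0" for k s0
  proof -
    have mem0: "imem s0 ''d'' 0 = int d" "rmem s0 ''a'' = rmem s ''a''" "rmem s0 ''b'' = rmem s ''b''"
      using same0 d by (simp_all add: same_def)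
    obtain m1 s1 where 1: "exec (dot_prog ''a'' (IConst 0) ''b'' ?id) s0 m1 s1"
      "same {''j''} {''acc''} s0 s1" "m1 \<le> 13 + d * 38"
      "rmem s1 ''acc'' 0 = dot d (\<lambda>j. rmem s0 ''a'' (0 + int j)) (\<lambda>j. rmem s0 ''b'' (int k * int d + int j))"
      by (rule wpE[OF wp_dot_prog[of s0 d "''a''" "''b''" "IConst 0" ?id 0 "int k * int d"]])
        (use mem0 i0 in \<open>auto simp: same_def\<close>)
    let ?s1 = "rupdate ''fac'' 0 (rmem s1 ''acc'' 0) s1"
    obtain m2 s2 where 2: "exec (dot_prog ''b'' ?id ''b'' ?id) ?s1 m2 s2"
      "same {''j''} {''acc''} ?s1 s2" "m2 \<le> 13 + d * 38"
      "rmem s2 ''acc'' 0 = dot d (\<lambda>j. rmem ?s1 ''b'' (int k * int d + int j)) (\<lambda>j. rmem ?s1 ''b'' (int k * int d + int j))"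
      by (rule wpE[OF wp_dot_prog[of ?s1 d "''b''" "''b''" ?id ?id "int k * int d" "int k * int d"]])
        (use mem0 i0 1(2) in \<open>auto simp: same_def\<close>)
    let ?s2 = "rupdate ''acc'' 0 (- (rmem s2 ''fac'' 0 / rmem s2 ''acc'' 0)) s2"
    obtain m3 s3 where 3: "exec (axpy_prog ''z'' ''b'' ?id) ?s2 m3 s3"
      "m3 \<le> 9 + d * 32" "\<forall>j<d. rmem s3 ''z'' (int j) = rmem ?s2 ''z'' (int j) +
         rmem ?s2 ''acc'' 0 * rmem ?s2 ''b'' (int k * int d + int j)"
      by (rule wpE[OF wp_axpy_prog[of ?s2 d "''b''" "''z''" ?id "int k * int d"]])
        (use mem0 i0 1(2) 2(2) in \<open>auto simp: same_def\<close>)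
    have "rmem s2 ''fac'' 0 = dot d h (g k)" "rmem s2 ''acc'' 0 = dot d (g k) (g k)"
      using 1(2,4) 2(2,4) mem0 a b k by (auto simp: same_def intro: dot_cong)
    then have "?I (Suc k) s3"
      using 3(3) 1(2) 2(2) mem0 b k z0 by (simp add: same_def)
    then show ?thesis
      using 1(3) 2(3) 3(2)
      by simp (rule wp_exec[OF 1(1)], rule wp_exec[OF 2(1)], rule wp_exec[OF 3(1)], simp)
  qed
  have "wp (for_loop ''i'' (ivar ''r'') ?c) (\<lambda>m s'. m \<le> icost (ivar ''r'') + 7 +
      r * (d * 108 + 58 + icost (ivar ''r'') + 10) \<and> ?I r s') s"
  proof (rule wp_for_loop[where I = ?I])
    show "?I 0 s" using z by simp
  qed (fact step | use r in \<open>simp add: same_def\<close>)+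
  then show ?thesis
    unfolding project_prog_def by (rule wp_frame) auto
qed

text \<open>The frame property speaks of whole arrays only, so the survival of the residuals stored
  below address r * d has to be part of the conclusion.\<close>

lemma wp_store_prog:
  assumes "imem s ''d'' 0 = int d" "imem s ''r'' 0 = int r"
  shows "wp store_prog (\<lambda>m s'. m \<le> 9 + d * 26 \<and>
      (\<forall>j<d. rmem s' ''b'' (int r * int d + int j) = rmem s ''z'' (int j)) \<and>
      (\<forall>l < int r * int d. rmem s' ''b'' l = rmem s ''b'' l)) s"
  unfolding store_prog_def
  by (rule wp_frame, rule wp_for_loop[where N = d and t = 14 and I = "\<lambda>k s'.
      (\<forall>j<k. rmem s' ''b'' (int r * int d + int j) = rmem s ''z'' (int j)) \<and>
      (\<forall>l < int r * int d. rmem s' ''b'' l = rmem s ''b'' l)"])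
    (use assms in \<open>auto simp: same_def less_Suc_eq\<close>)

lemma row_index_less: "i < r \<Longrightarrow> j < d \<Longrightarrow> int i * int d + int j < int r * int d"
proof -
  assume "i < r" "j < d"
  then have "i * d + j < Suc i * d" "Suc i * d \<le> r * d"
    by (simp, intro mult_le_mono1) simp
  then have "i * d + j < r * d"
    by linarith
  then show ?thesis
    by (metis of_nat_add of_nat_less_iff of_nat_mult)
qed

definition step_time :: "nat \<Rightarrow> nat" where
  "step_time d = 200 + d * 300 + d * (70 + d * 108)"

lemma wp_step_prog:
  assumes mem: "imem s ''d'' 0 = int d" "imem s ''r'' 0 = int r" and r: "r < d"
    and rows: "\<And>j. j < d \<Longrightarrow> rmem s ''D'' (imem s ''c'' (int (2 * r)) * int d + int j) -
      rmem s ''D'' (imem s ''c'' (int (2 * r + 1)) * int d + int j) = a r j"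
    and b: "\<forall>i<r. \<forall>j<d. rmem s ''b'' (int i * int d + int j) = gram_schmidt d a i j"
    and u: "\<forall>j<d. rmem s ''u'' (int j) = solve_ones d a r j"
  shows "wp step_prog (\<lambda>m s'. m \<le> step_time d \<and>
      (\<forall>i<Suc r. \<forall>j<d. rmem s' ''b'' (int i * int d + int j) = gram_schmidt d a i j) \<and>
      (\<forall>j<d. rmem s' ''u'' (int j) = solve_ones d a (Suc r) j)) s"
proof -
  \<comment> \<open>Projecting on the r earlier residuals is charged as if there were d of them,
    which makes the bound the same for all rows.\<close>
  have time: "r * (70 + d * 108) \<le> d * (70 + d * 108)"
    using r by (intro mult_le_mono1) simp
  have g: "gram_schmidt d a r j = a r j - (\<Sum>i<r. dot d (a r) (gram_schmidt d a i) /
      dot d (gram_schmidt d a i) (gram_schmidt d a i) * gram_schmidt d a i j)" for j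
    by (subst gram_schmidt.simps) simp
  have b_index: "int i * int d + int j < int r * int d" if "i < r" "j < d" for i j
    using that by (rule row_index_less)
  let ?s0 = "iupdate ''row2'' 0 (imem s ''c'' (2 * int r + 1) * int d)
      (iupdate ''row1'' 0 (imem s ''c'' (2 * int r) * int d) s)"
  obtain m1 s1 where 1: "exec load_prog ?s0 m1 s1" "same {''j''} {''a'', ''z''} ?s0 s1" "m1 \<le> 9 + d * 38"
    "\<forall>j<d. rmem s1 ''a'' (int j) = rmem ?s0 ''D'' (imem ?s0 ''row1'' 0 + int j) -
        rmem ?s0 ''D'' (imem ?s0 ''row2'' 0 + int j) \<and> rmem s1 ''z'' (int j) = rmem s1 ''a'' (int j)"
    by (rule wpE[OF wp_load_prog[of ?s0 d]]) (use mem in auto)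
  have a1: "\<forall>j<d. rmem s1 ''a'' (int j) = a r j" "\<forall>j<d. rmem s1 ''z'' (int j) = a r j"
    using 1(4) rows by (simp_all add: algebra_simps)
  have mem1: "imem s1 ''d'' 0 = int d" "imem s1 ''r'' 0 = int r" "rmem s1 ''b'' = rmem s ''b''"
    "rmem s1 ''u'' = rmem s ''u''"
    using 1(2) mem by (simp_all add: same_def)
  obtain m2 s2 where 2: "exec project_prog s1 m2 s2" "same {''i'', ''j''} {''acc'', ''fac'', ''z''} s1 s2"
    "m2 \<le> 9 + r * (70 + d * 108)" "\<forall>j<d. rmem s2 ''z'' (int j) = gram_schmidt d a r j"
    by (rule wpE[OF wp_project_prog[of s1 d r "gram_schmidt d a" "a r"]])
      (use mem1 a1 b in \<open>auto simp: g\<close>)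
  have mem2: "imem s2 ''d'' 0 = int d" "imem s2 ''r'' 0 = int r" "rmem s2 ''a'' = rmem s1 ''a''"
    "rmem s2 ''b'' = rmem s ''b''" "rmem s2 ''u'' = rmem s ''u''"
    using 2(2) mem1 by (simp_all add: same_def)
  obtain m3 s3 where 3: "exec store_prog s2 m3 s3" "same {''j''} {''b''} s2 s3" "m3 \<le> 9 + d * 26"
    "\<forall>j<d. rmem s3 ''b'' (int r * int d + int j) = rmem s2 ''z'' (int j)"
    "\<forall>l < int r * int d. rmem s3 ''b'' l = rmem s2 ''b'' l"
    by (rule wpE[OF wp_store_prog[of s2 d r]]) (use mem2 in auto)
  have mem3: "imem s3 ''d'' 0 = int d" "rmem s3 ''a'' = rmem s1 ''a''" "rmem s3 ''z'' = rmem s2 ''z''"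
    "rmem s3 ''u'' = rmem s ''u''"
    using 3(2) mem2 by (simp_all add: same_def)
  have b3: "\<forall>i<Suc r. \<forall>j<d. rmem s3 ''b'' (int i * int d + int j) = gram_schmidt d a i j"
    using 2(4) 3(4,5) mem2 b b_index by (auto simp: less_Suc_eq)
  obtain m4 s4 where 4: "exec (dot_prog ''a'' (IConst 0) ''u'' (IConst 0)) s3 m4 s4"
    "same {''j''} {''acc''} s3 s4" "m4 \<le> 13 + d * 38"
    "rmem s4 ''acc'' 0 = dot d (\<lambda>j. rmem s3 ''a'' (0 + int j)) (\<lambda>j. rmem s3 ''u'' (0 + int j))"
    by (rule wpE[OF wp_dot_prog[of s3 d "''a''" "''u''" "IConst 0" "IConst 0" 0 0]]) (use mem3 in auto)
  let ?s4 = "rupdate ''fac'' 0 (1 - rmem s4 ''acc'' 0) s4"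
  obtain m5 s5 where 5: "exec (dot_prog ''z'' (IConst 0) ''z'' (IConst 0)) ?s4 m5 s5"
    "same {''j''} {''acc''} ?s4 s5" "m5 \<le> 13 + d * 38"
    "rmem s5 ''acc'' 0 = dot d (\<lambda>j. rmem ?s4 ''z'' (0 + int j)) (\<lambda>j. rmem ?s4 ''z'' (0 + int j))"
    by (rule wpE[OF wp_dot_prog[of ?s4 d "''z''" "''z''" "IConst 0" "IConst 0" 0 0]])
      (use mem3 4(2) in \<open>auto simp: same_def\<close>)
  let ?s5 = "rupdate ''acc'' 0 (rmem s5 ''fac'' 0 / rmem s5 ''acc'' 0) s5"
  obtain m6 s6 where 6: "exec (axpy_prog ''u'' ''z'' (IConst 0)) ?s5 m6 s6"
    "same {''j''} {''u''} ?s5 s6" "m6 \<le> 9 + d * 32"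
    "\<forall>j<d. rmem s6 ''u'' (int j) = rmem ?s5 ''u'' (int j) + rmem ?s5 ''acc'' 0 * rmem ?s5 ''z'' (0 + int j)"
    by (rule wpE[OF wp_axpy_prog[of ?s5 d "''z''" "''u''" "IConst 0" 0]])
      (use mem3 4(2) 5(2) in \<open>auto simp: same_def\<close>)
  have "rmem s5 ''fac'' 0 = 1 - dot d (a r) (solve_ones d a r)"
    "rmem s5 ''acc'' 0 = dot d (gram_schmidt d a r) (gram_schmidt d a r)"
    using 4(2,4) 5(2,4) mem3 a1 2(4) u by (auto simp: same_def intro: dot_cong)
  then have u6: "\<forall>j<d. rmem s6 ''u'' (int j) = solve_ones d a (Suc r) j"
    using 6(4) 5(2) 4(2) mem3 2(4) u by (simp add: same_def)
  have b6: "rmem s6 ''b'' = rmem s3 ''b''"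
    using 6(2) 5(2) 4(2) by (simp add: same_def)
  have "18 + m1 + m2 + m3 + m4 + m5 + m6 + 50 \<le> step_time d"
    using 1(3) 2(3) 3(3) 4(3) 5(3) 6(3) time unfolding step_time_def by linarith
  then show ?thesis
    unfolding step_prog_def using mem b3[folded b6] u6
    by simp (rule wp_exec[OF 1(1)], rule wp_exec[OF 2(1)], rule wp_exec[OF 3(1)], rule wp_exec[OF 4(1)],
      rule wp_exec[OF 5(1)], rule wp_exec[OF 6(1)], simp)
qed

definition solve_time :: "nat \<Rightarrow> nat" where
  "solve_time d = 20 + d * 30 + d * (12 + step_time d)"

lemma wp_solve_prog:
  assumes d: "imem s ''d'' 0 = int d"
    and rows: "\<And>i j. i < d \<Longrightarrow> j < d \<Longrightarrow> rmem s ''D'' (imem s ''c'' (int (2 * i)) * int d + int j) -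
      rmem s ''D'' (imem s ''c'' (int (2 * i + 1)) * int d + int j) = a i j"
  shows "wp solve_prog (\<lambda>m s'. m \<le> solve_time d \<and>
      (\<forall>j<d. rmem s' ''u'' (int j) = solve_ones d a d j)) s"
proof -
  let ?c = "RWrite ''u'' (ivar ''j'') (RInt (IConst 0))"
  let ?I = "\<lambda>k s'. (\<forall>i<k. \<forall>j<d. rmem s' ''b'' (int i * int d + int j) = gram_schmidt d a i j) \<and>
    (\<forall>j<d. rmem s' ''u'' (int j) = solve_ones d a k j)"
  have "wp (for_loop ''j'' (ivar ''d'') ?c) (\<lambda>m s'. m \<le> icost (ivar ''d'') + 7 +
      d * (5 + icost (ivar ''d'') + 10) \<and> (\<forall>j<d. rmem s' ''u'' (int j) = 0)) s"
    by (rule wp_for_loop[where I = "\<lambda>k s'. \<forall>j<k. rmem s' ''u'' (int j) = 0"])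
      (use d in \<open>auto simp: same_def less_Suc_eq\<close>)
  then obtain m1 s1 where 1: "exec (for_loop ''j'' (ivar ''d'') ?c) s m1 s1" "same {''j''} {''u''} s s1"
    "m1 \<le> 9 + d * 17" "\<forall>j<d. rmem s1 ''u'' (int j) = 0"
    by (rule wpE) auto
  have "wp (for_loop ''r'' (ivar ''d'') step_prog) (\<lambda>m s'. m \<le> icost (ivar ''d'') + 7 +
      d * (step_time d + icost (ivar ''d'') + 10) \<and> ?I d s') s1"
  proof (rule wp_for_loop[where I = ?I])
    fix k s' assume k: "k < d" and same: "same (insert ''r'' (iwrites step_prog)) (rwrites step_prog) s1 s'"
      and r: "imem s' ''r'' 0 = int k" and I: "?I k s'"
    show "wp step_prog (\<lambda>m s''. m \<le> step_time d \<and> ?I (Suc k) s'') s'"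
    proof (rule wp_step_prog)
      show "imem s' ''d'' 0 = int d"
        using same 1(2) d by (simp add: same_def)
      show "rmem s' ''D'' (imem s' ''c'' (int (2 * k)) * int d + int j) -
        rmem s' ''D'' (imem s' ''c'' (int (2 * k + 1)) * int d + int j) = a k j" if "j < d" for j
        using same 1(2) rows[OF k that] by (simp add: same_def)
    qed (use k r I in auto)
  qed (use d 1 in \<open>auto simp: same_def\<close>)
  then obtain m2 s2 where 2: "exec (for_loop ''r'' (ivar ''d'') step_prog) s1 m2 s2"
    "m2 \<le> 9 + d * (12 + step_time d)" "\<forall>j<d. rmem s2 ''u'' (int j) = solve_ones d a d j"
    by (rule wpE) auto
  have "m1 + m2 \<le> solve_time d"
    using 1(3) 2(2) by (simp add: solve_time_def)
  with 2(3) show ?thesis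
    unfolding solve_prog_def by simp (rule wp_exec[OF 1(1)], rule wp_exec[OF 2(1)], simp)
qed

lemma wp_score_prog:
  assumes mem: "imem s ''d'' 0 = int d" "imem s ''n'' 0 = int n"
  shows "wp score_prog (\<lambda>m s'. m \<le> 9 + n * (40 + d * 38) \<and>
      (\<forall>p<n. rmem s' ''x'' (int p) = dot d (\<lambda>j. rmem s ''u'' (int j))
         (\<lambda>j. rmem s ''D'' (imem s ''pi'' (int p) * int d + int j)))) s"
proof -
  let ?c = "dot_prog ''u'' (IConst 0) ''D'' (IMul (IRead ''pi'' (ivar ''p'')) (ivar ''d''));;
        RWrite ''x'' (ivar ''p'') (rvar ''acc'')"
  let ?I = "\<lambda>k s'. \<forall>p<k. rmem s' ''x'' (int p) = dot d (\<lambda>j. rmem s ''u'' (int j))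
         (\<lambda>j. rmem s ''D'' (imem s ''pi'' (int p) * int d + int j))"
  have "wp (for_loop ''p'' (ivar ''n'') ?c) (\<lambda>m s'. m \<le> icost (ivar ''n'') + 7 +
      n * (d * 38 + 28 + icost (ivar ''n'') + 10) \<and> ?I n s') s"
  proof (rule wp_for_loop[where I = ?I])
    fix k s' assume k: "k < n" and same: "same (insert ''p'' (iwrites ?c)) (rwrites ?c) s s'"
      and p: "imem s' ''p'' 0 = int k" and I: "?I k s'"
    have mem': "imem s' ''d'' 0 = int d" "imem s' ''pi'' = imem s ''pi''" "rmem s' ''u'' = rmem s ''u''"
      "rmem s' ''D'' = rmem s ''D''"
      using mem same by (simp_all add: same_def)
    obtain m1 s1 where 1: "exec (dot_prog ''u'' (IConst 0) ''D'' (IMul (IRead ''pi'' (ivar ''p'')) (ivar ''d''))) s' m1 s1"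
      "same {''j''} {''acc''} s' s1" "m1 \<le> 13 + d * 38"
      "rmem s1 ''acc'' 0 = dot d (\<lambda>j. rmem s' ''u'' (0 + int j))
         (\<lambda>j. rmem s' ''D'' (imem s ''pi'' (int k) * int d + int j))"
      by (rule wpE[OF wp_dot_prog[of s' d "''u''" "''D''" "IConst 0" "IMul (IRead ''pi'' (ivar ''p'')) (ivar ''d'')"
              0 "imem s ''pi'' (int k) * int d"]])
        (use mem' p in \<open>auto simp: same_def\<close>)
    show "wp ?c (\<lambda>m s''. m \<le> d * 38 + 28 \<and> ?I (Suc k) s'') s'"
      using 1(2-4) mem' p I
      by simp (rule wp_exec[OF 1(1)], simp add: same_def less_Suc_eq)
  qed (use mem in \<open>auto simp: same_def\<close>)
  then show ?thesis
    unfolding score_prog_def by (rule wp_frame) auto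
qed

section \<open>Longest decreasing subsequence and bonuses\<close>

text \<open>\<open>level q\<close> is the length of a longest strictly decreasing subsequence ending at position \<open>q\<close>,
  and \<open>tail l\<close> is a position of level \<open>l\<close> with the largest score; \<open>-1\<close> means that there is none.\<close>

definition lis_inv ::
    "(int \<Rightarrow> real) \<Rightarrow> (int \<Rightarrow> int) \<Rightarrow> (int \<Rightarrow> int) \<Rightarrow> (int \<Rightarrow> int) \<Rightarrow> int \<Rightarrow> int \<Rightarrow> bool" where
  "lis_inv x level pred tail len p \<longleftrightarrow>
     tail 0 = -1 \<and> 0 \<le> len \<and> len \<le> p \<and>
     (\<forall>l. 1 \<le> l \<and> l \<le> len \<longrightarrow> 0 \<le> tail l \<and> tail l < p \<and> level (tail l) = l) \<and>
     (\<forall>l l'. 1 \<le> l \<and> l < l' \<and> l' \<le> len \<longrightarrow> x (tail l') < x (tail l)) \<and>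
     (\<forall>q. 0 \<le> q \<and> q < p \<longrightarrow> 1 \<le> level q \<and> level q \<le> len \<and> x q \<le> x (tail (level q))) \<and>
     (\<forall>q q'. 0 \<le> q \<and> q < q' \<and> q' < p \<and> x q' < x q \<longrightarrow> level q < level q') \<and>
     (\<forall>q. 0 \<le> q \<and> q < p \<and> 1 < level q \<longrightarrow>
        0 \<le> pred q \<and> pred q < q \<and> level (pred q) = level q - 1 \<and> x q < x (pred q)) \<and>
     (\<forall>q. 0 \<le> q \<and> q < p \<and> level q = 1 \<longrightarrow> pred q = -1)"

text \<open>Here \<open>pos\<close> is the number of tails scoring above position p. So p extends a
  chain of length \<open>pos\<close>, and it may replace the tail of level \<open>pos + 1\<close>,
  if there is one, because it scores at least as much.\<close>

lemma lis_inv_step: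
  assumes inv: "lis_inv x level pred tail len p"
    and pos: "0 \<le> pos" "pos \<le> len" "\<And>l. 1 \<le> l \<Longrightarrow> l \<le> pos \<Longrightarrow> x p < x (tail l)"
      "\<And>l. pos < l \<Longrightarrow> l \<le> len \<Longrightarrow> x (tail l) \<le> x p"
  shows "lis_inv x (level(p := pos + 1)) (pred(p := tail pos)) (tail(pos + 1 := p))
    (max len (pos + 1)) (p + 1)"
proof -
  have tail: "0 \<le> tail l" "tail l < p" "level (tail l) = l" if "1 \<le> l" "l \<le> len" for l
    using inv that unfolding lis_inv_def by blast+
  have strict: "x (tail l') < x (tail l)" if "1 \<le> l" "l < l'" "l' \<le> len" for l l'
    using inv that unfolding lis_inv_def by blast
  have level: "1 \<le> level q" "level q \<le> len" "x q \<le> x (tail (level q))" if "0 \<le> q" "q < p" for q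
    using inv that unfolding lis_inv_def by blast+
  have mono: "level q < level q'" if "0 \<le> q" "q < q'" "q' < p" "x q' < x q" for q q'
    using inv that unfolding lis_inv_def by blast
  have pred: "0 \<le> pred q" "pred q < q" "level (pred q) = level q - 1" "x q < x (pred q)"
    if "0 \<le> q" "q < p" "1 < level q" for q
    using inv that unfolding lis_inv_def by blast+
  have pred1: "pred q = -1" if "0 \<le> q" "q < p" "level q = 1" for q
    using inv that unfolding lis_inv_def by blast
  have base: "tail 0 = -1" "0 \<le> len" "len \<le> p"
    using inv unfolding lis_inv_def by blast+
  show ?thesis
    unfolding lis_inv_def
  proof (intro conjI allI impI)
    show "(tail(pos + 1 := p)) 0 = -1" "0 \<le> max len (pos + 1)" "max len (pos + 1) \<le> p + 1"
      using base pos by auto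
  next
    fix l assume l: "1 \<le> l \<and> l \<le> max len (pos + 1)"
    have "l \<le> len" if "l \<noteq> pos + 1"
      using l that pos by linarith
    then show "0 \<le> (tail(pos + 1 := p)) l" "(tail(pos + 1 := p)) l < p + 1"
      "(level(p := pos + 1)) ((tail(pos + 1 := p)) l) = l"
      using l tail[of l] base pos by auto
  next
    fix l l' assume l: "1 \<le> l \<and> l < l' \<and> l' \<le> max len (pos + 1)"
    show "x ((tail(pos + 1 := p)) l') < x ((tail(pos + 1 := p)) l)"
    proof (cases "l' = pos + 1")
      case True
      then show ?thesis
        using l pos(3)[of l] by auto
    next
      case False
      then have "l' \<le> len"
        using l pos by linarith
      then show ?thesis
        using False l strict[of l l'] pos(4)[of l] by auto
    qed
  next
    fix q assume q: "0 \<le> q \<and> q < p + 1"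
    show "1 \<le> (level(p := pos + 1)) q" "(level(p := pos + 1)) q \<le> max len (pos + 1)"
      using q level[of q] pos by auto
    show "x q \<le> x ((tail(pos + 1 := p)) ((level(p := pos + 1)) q))"
      using q level[of q] pos(4)[of "pos + 1"] by fastforce
  next
    fix q q' assume q: "0 \<le> q \<and> q < q' \<and> q' < p + 1 \<and> x q' < x q"
    show "(level(p := pos + 1)) q < (level(p := pos + 1)) q'"
    proof (cases "q' = p")
      case True
      \<comment> \<open>The tail of the level of q scores at least as much as q, hence more than p,
        so it is among the first \<open>pos\<close> tails.\<close>
      have "level q \<le> pos"
      proof (rule ccontr)
        assume "\<not> level q \<le> pos"
        then have "x (tail (level q)) \<le> x p"
          using pos(4)[of "level q"] level[of q] q True by auto
        then show False
          using level(3)[of q] q True by auto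
      qed
      then show ?thesis
        using q True by auto
    next
      case False
      then show ?thesis
        using q mono[of q q'] by auto
    qed
  next
    fix q assume q: "0 \<le> q \<and> q < p + 1 \<and> 1 < (level(p := pos + 1)) q"
    show "0 \<le> (pred(p := tail pos)) q" "(pred(p := tail pos)) q < q"
      "(level(p := pos + 1)) ((pred(p := tail pos)) q) = (level(p := pos + 1)) q - 1"
      "x q < x ((pred(p := tail pos)) q)"
      using q tail[of pos] pos(2) pos(3)[of pos] pred[of q] by (auto split: if_splits)
  next
    fix q assume q: "0 \<le> q \<and> q < p + 1 \<and> (level(p := pos + 1)) q = 1"
    then show "(pred(p := tail pos)) q = -1"
      using base pred1[of q] by (auto split: if_splits)
  qed
qed

text \<open>Optimality: levels increase strictly along a decreasing subsequence, so its members have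
  distinct levels between 1 and \<open>len\<close>.\<close>

lemma lis_inv_card_le:
  assumes inv: "lis_inv x level pred tail len p" and A: "A \<subseteq> {0..<p}"
    and decreasing: "\<And>q q'. q \<in> A \<Longrightarrow> q' \<in> A \<Longrightarrow> q < q' \<Longrightarrow> x q' < x q"
  shows "int (card A) \<le> len"
proof -
  have level: "1 \<le> level q" "level q \<le> len" if "0 \<le> q" "q < p" for q
    using inv that unfolding lis_inv_def by blast+
  have mono: "level q < level q'" if "0 \<le> q" "q < q'" "q' < p" "x q' < x q" for q q'
    using inv that unfolding lis_inv_def by blast
  have less: "level q < level q'" if "q \<in> A" "q' \<in> A" "q < q'" for q q'
    using A decreasing[OF that] that by (intro mono) auto
  have "inj_on level A"
    using less by (intro inj_onI) (metis less_irrefl linorder_neqE)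
  moreover have "level ` A \<subseteq> {1..len}"
    using A level by fastforce
  ultimately have "card A \<le> card {1..len}"
    by (intro card_inj_on_le) auto
  moreover have "0 \<le> len"
    using inv by (simp add: lis_inv_def)
  ultimately show ?thesis
    by simp
qed

text \<open>The bonuses are assigned from the last to the first position; \<open>low\<close> is the adjusted score
  assigned last, and \<open>cur\<close> is the next position of the chosen chain, which gets bonus 0.\<close>

definition sweep_inv ::
    "(int \<Rightarrow> real) \<Rightarrow> (int \<Rightarrow> int) \<Rightarrow> int \<Rightarrow> int \<Rightarrow> int \<Rightarrow> (int \<Rightarrow> real) \<Rightarrow> int \<Rightarrow> real \<Rightarrow> bool" where
  "sweep_inv x level len n p V cur low \<longleftrightarrow>
     -1 \<le> cur \<and> cur < p \<and> (0 \<le> cur \<longrightarrow> low < x cur) \<and>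
     (\<forall>q. p \<le> q \<and> q < n \<longrightarrow> x q + V q \<le> low) \<and>
     (\<forall>q q'. p \<le> q \<and> q < q' \<and> q' < n \<longrightarrow> x q' + V q' < x q + V q) \<and>
     int (card {q \<in> {p..<n}. V q \<noteq> 0}) + len \<le> n - p + (if cur < 0 then 0 else level cur)"

lemma sweep_inv_init:
  assumes "lis_inv x level pred tail len n"
  shows "sweep_inv x level len n n V (tail len) (x (tail len) - 1)"
proof (cases "len = 0")
  \<comment> \<open>Now \<open>tail 0 = -1\<close> says that no chain has to be followed, and the
    cell read at index -1 for \<open>low\<close> has no bearing on any position.\<close>
  case True
  then show ?thesis
    using assms by (simp add: sweep_inv_def lis_inv_def)
next
  case False
  then have "0 \<le> tail len \<and> tail len < n \<and> level (tail len) = len"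
    using assms unfolding lis_inv_def by auto
  then show ?thesis
    by (simp add: sweep_inv_def)
qed

text \<open>\<open>level cur\<close> counts the chain members still to come. A chain position keeps
  its score, adds no bonus and lowers that count by one; any other position adds at most one bonus
  and is placed strictly between \<open>low\<close> and the next chain score. In both cases the
  counting clause survives.\<close>

lemma sweep_inv_step:
  assumes lis: "lis_inv x level pred tail len n"
    and sweep: "sweep_inv x level len n (p + 1) V cur low"
    and p: "0 \<le> p" "p < n"
    and V': "\<And>q. p < q \<Longrightarrow> q < n \<Longrightarrow> V' q = V q" "V' p = low' - x p"
    and cases: "cur = p \<and> low' = x p \<and> cur' = pred p \<or>
      cur \<noteq> p \<and> cur' = cur \<and> low < low' \<and> (0 \<le> cur \<longrightarrow> low' < x cur)"
  shows "sweep_inv x level len n p V' cur' low'"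
proof -
  have low: "low < low'"
    using cases sweep p unfolding sweep_inv_def by auto
  have old: "\<And>q. p + 1 \<le> q \<and> q < n \<Longrightarrow> x q + V q \<le> low"
    "\<And>q q'. p + 1 \<le> q \<and> q < q' \<and> q' < n \<Longrightarrow> x q' + V q' < x q + V q"
    "int (card {q \<in> {p + 1..<n}. V q \<noteq> 0}) + len \<le> n - (p + 1) + (if cur < 0 then 0 else level cur)"
    "-1 \<le> cur" "cur < p + 1" "0 \<le> cur \<longrightarrow> low < x cur"
    using sweep unfolding sweep_inv_def by blast+
  have "{q \<in> {p..<n}. V' q \<noteq> 0} = (if V' p = 0 then {} else {p}) \<union> {q \<in> {p + 1..<n}. V q \<noteq> 0}"
    using p V' by (auto simp: order_le_less)
  moreover have "finite {q \<in> {p + 1..<n}. V q \<noteq> 0}" "p \<notin> {q \<in> {p + 1..<n}. V q \<noteq> 0}"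
    by (simp_all add: finite_Collect_conjI del: atLeastLessThan_iff) simp
  ultimately have card: "card {q \<in> {p..<n}. V' q \<noteq> 0} =
      (if V' p = 0 then 0 else 1) + card {q \<in> {p + 1..<n}. V q \<noteq> 0}"
    by (simp only: card_insert_disjoint Un_insert_left Un_empty_left split: if_split) simp
  have pred: "level p = 1 \<and> pred p = -1 \<or>
      1 < level p \<and> 0 \<le> pred p \<and> pred p < p \<and> level (pred p) = level p - 1 \<and> x p < x (pred p)"
  proof -
    have "1 \<le> level p"
      using lis p unfolding lis_inv_def by blast
    then consider "level p = 1" | "1 < level p"
      by linarith
    then show ?thesis
      using lis p unfolding lis_inv_def by cases blast+
  qed
  show ?thesis
    unfolding sweep_inv_def
  proof (intro conjI allI impI)
    show "low' < x cur'" if "0 \<le> cur'"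
      using that cases pred old p by auto
    show "-1 \<le> cur'" "cur' < p"
      using cases pred old p by auto
    show "x q + V' q \<le> low'" if "p \<le> q \<and> q < n" for q
      using that V' low old(1)[of q] by (cases "q = p") auto
    show "x q' + V' q' < x q + V' q" if "p \<le> q \<and> q < q' \<and> q' < n" for q q'
      using that V' low old(1)[of q'] old(2)[of q q'] by (cases "q = p") auto
    show "int (card {q \<in> {p..<n}. V' q \<noteq> 0}) + len \<le> n - p + (if cur' < 0 then 0 else level cur')"
      using cases
    proof
      assume c: "cur = p \<and> low' = x p \<and> cur' = pred p"
      then have "V' p = 0"
        using V' by simp
      then show ?thesis
        using c card old(3) pred p by auto
    next
      assume c: "cur \<noteq> p \<and> cur' = cur \<and> low < low' \<and> (0 \<le> cur \<longrightarrow> low' < x cur)"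
      then show ?thesis
        using card old(3) by (auto split: if_splits)
    qed
  qed
qed

section \<open>Programs for patience sorting and for the bonuses\<close>

definition search_prog :: com where
  "search_prog =
     (iset ''pos'' (IConst 0);;
      for_loop ''j'' (ivar ''K'')
        (iset ''q'' (IAdd (ivar ''pos'') (IRead ''pow'' (ISub (ISub (ivar ''K'') (IConst 1)) (ivar ''j''))));;
         If (BAnd (BNot (ILess (ivar ''len'') (ivar ''q'')))
               (RLess (RRead ''x'' (ivar ''p'')) (RRead ''x'' (IRead ''tail'' (ivar ''q'')))))
           (iset ''pos'' (ivar ''q'')) Skip))"

text \<open>\<open>tail\<close> is not cleared between candidates: entries above \<open>len\<close>
  are stale, and \<open>lis_inv\<close> speaks only of levels up to \<open>len\<close>. The marker
  -1 in cell 0 survives because writes go to \<open>pos + 1\<close>, which is positive.\<close>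

definition lis_prog :: com where
  "lis_prog =
     (iset ''len'' (IConst 0);;
      for_loop ''p'' (ivar ''n'')
        (search_prog;;
         IWrite ''level'' (ivar ''p'') (IAdd (ivar ''pos'') (IConst 1));;
         IWrite ''pred'' (ivar ''p'') (IRead ''tail'' (ivar ''pos''));;
         IWrite ''tail'' (IAdd (ivar ''pos'') (IConst 1)) (ivar ''p'');;
         If (ILess (ivar ''len'') (IAdd (ivar ''pos'') (IConst 1)))
           (iset ''len'' (IAdd (ivar ''pos'') (IConst 1))) Skip))"

text \<open>Off the chain, the adjusted score is the midpoint between \<open>low\<close> and the
  next chain score, or \<open>low + 1\<close> once the chain is exhausted. On the chain
  \<open>low\<close> is the score itself, so the bonus is exactly 0.\<close>

definition output_prog :: com where
  "output_prog =
     (for_loop ''j'' (ivar ''d'') (RWrite ''w'' (ivar ''j'') (RRead ''u'' (ivar ''j'')));;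
      iset ''cur'' (IRead ''tail'' (ivar ''len''));;
      rset ''low'' (RSub (RRead ''x'' (ivar ''cur'')) (RInt (IConst 1)));;
      for_loop ''i'' (ivar ''n'')
        (iset ''p'' (ISub (ISub (ivar ''n'') (IConst 1)) (ivar ''i''));;
         If (BAnd (BNot (ILess (ivar ''p'') (ivar ''cur''))) (BNot (ILess (ivar ''cur'') (ivar ''p''))))
           (rset ''low'' (RRead ''x'' (ivar ''p''));; iset ''cur'' (IRead ''pred'' (ivar ''p'')))
           (If (ILess (ivar ''cur'') (IConst 0))
              (rset ''low'' (RAdd (rvar ''low'') (RInt (IConst 1))))
              (rset ''low'' (RDiv (RAdd (rvar ''low'') (RRead ''x'' (ivar ''cur''))) (RInt (IConst 2)))));;
         RWrite ''v'' (IRead ''pi'' (ivar ''p'')) (RSub (rvar ''low'') (RRead ''x'' (ivar ''p'')))))"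

lemma writes_lis [simp]:
  "iwrites search_prog = {''pos'', ''j'', ''q''}" "rwrites search_prog = {}"
  "iwrites lis_prog = {''len'', ''p'', ''pos'', ''j'', ''q'', ''level'', ''pred'', ''tail''}" "rwrites lis_prog = {}"
  "iwrites output_prog = {''j'', ''cur'', ''i'', ''p''}" "rwrites output_prog = {''w'', ''low'', ''v''}"
  by (auto simp: search_prog_def lis_prog_def output_prog_def)

text \<open>Binary lifting: the bits of \<open>pos\<close> are tried from the highest power
  downwards, so no midpoint is ever computed. A trial index beyond \<open>len\<close> may read a
  stale tail, but the comparison with \<open>len\<close> rejects it.\<close>

lemma wp_search_prog:
  fixes K :: nat
  assumes K: "imem s ''K'' 0 = int K" and pow: "\<And>j. j < K \<Longrightarrow> imem s ''pow'' (int j) = 2 ^ j"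
    and len: "0 \<le> imem s ''len'' 0" "imem s ''len'' 0 < 2 ^ K"
    and strict: "\<And>l l'. 1 \<le> l \<Longrightarrow> l < l' \<Longrightarrow> l' \<le> imem s ''len'' 0 \<Longrightarrow>
      rmem s ''x'' (imem s ''tail'' l') < rmem s ''x'' (imem s ''tail'' l)"
  shows "wp search_prog (\<lambda>m s'. m \<le> 12 + K * 60 \<and>
      0 \<le> imem s' ''pos'' 0 \<and> imem s' ''pos'' 0 \<le> imem s ''len'' 0 \<and>
      (\<forall>l. 1 \<le> l \<and> l \<le> imem s' ''pos'' 0 \<longrightarrow>
         rmem s ''x'' (imem s ''p'' 0) < rmem s ''x'' (imem s ''tail'' l)) \<and>
      (\<forall>l. imem s' ''pos'' 0 < l \<and> l \<le> imem s ''len'' 0 \<longrightarrow>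
         rmem s ''x'' (imem s ''tail'' l) \<le> rmem s ''x'' (imem s ''p'' 0))) s"
proof -
  define len where "len = imem s ''len'' 0"
  define y where "y l = rmem s ''x'' (imem s ''tail'' l)" for l
  define c where "c = rmem s ''x'' (imem s ''p'' 0)"
  let ?s = "iupdate ''pos'' 0 0 s"
  let ?c = "iset ''q'' (IAdd (ivar ''pos'') (IRead ''pow'' (ISub (ISub (ivar ''K'') (IConst 1)) (ivar ''j''))));;
         If (BAnd (BNot (ILess (ivar ''len'') (ivar ''q'')))
               (RLess (RRead ''x'' (ivar ''p'')) (RRead ''x'' (IRead ''tail'' (ivar ''q'')))))
           (iset ''pos'' (ivar ''q'')) Skip"
  have y: "y l' < y l" if "1 \<le> l" "l < l'" "l' \<le> len" for l l'
    using strict[of l l'] that by (simp add: y_def len_def)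
  \<comment> \<open>After k rounds the number of tails scoring above c is at least
    \<open>pos\<close> and below \<open>pos + 2 ^ (K - k)\<close>. At the start this is the
    assumption \<open>len < 2 ^ K\<close>; at the end the number is \<open>pos\<close>.\<close>
  define P where "P k pos \<longleftrightarrow> 0 \<le> pos \<and> pos \<le> len \<and> (1 \<le> pos \<longrightarrow> c < y pos) \<and>
      (\<forall>l. pos + 2 ^ (K - k) \<le> l \<and> l \<le> len \<longrightarrow> y l \<le> c)" for k pos
  have step: "P (Suc k) (if q \<le> len \<and> c < y q then q else pos)"
    if "P k pos" and k: "k < K" and q: "q = pos + 2 ^ (K - 1 - k)" for k pos q
  proof -
    note P = \<open>P k pos\<close>[unfolded P_def]
    have "(2::int) ^ (K - k) = 2 * 2 ^ (K - 1 - k)"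
      using k by (metis Suc_diff_Suc diff_Suc_eq_diff_pred power_Suc)
    then have pq: "pos + 2 ^ (K - k) = q + 2 ^ (K - Suc k)" "pos + 2 ^ (K - Suc k) = q"
      using q by simp_all
    have "pos < q"
      using q by simp
    have "y l \<le> c" if "\<not> (q \<le> len \<and> c < y q)" "q \<le> l" "l \<le> len" for l
      using that y[of q l] P \<open>pos < q\<close> by (cases "l = q") fastforce+
    then show ?thesis
      using P pq \<open>pos < q\<close> unfolding P_def by (auto simp: add.commute)
  qed
  have "wp (for_loop ''j'' (ivar ''K'') ?c) (\<lambda>m s'. m \<le> icost (ivar ''K'') + 7 +
      K * (48 + icost (ivar ''K'') + 10) \<and> P K (imem s' ''pos'' 0)) ?s"
  proof (rule wp_for_loop[where I = "\<lambda>k s'. P k (imem s' ''pos'' 0)"])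
    fix k s' assume k: "k < K" and same: "same (insert ''j'' (iwrites ?c)) (rwrites ?c) ?s s'"
      and j: "imem s' ''j'' 0 = int k" and "P k (imem s' ''pos'' 0)"
    have mem: "imem s' ''K'' 0 = int K" "imem s' ''pow'' = imem s ''pow''" "imem s' ''len'' 0 = len"
      "imem s' ''p'' = imem s ''p''" "imem s' ''tail'' = imem s ''tail''" "rmem s' ''x'' = rmem s ''x''"
      using same K by (simp_all add: same_def len_def)
    have K_k: "int K - 1 - int k = int (K - 1 - k)"
      using k by auto
    have "imem s ''pow'' (int K - 1 - int k) = 2 ^ (K - 1 - k)"
      unfolding K_k using k by (intro pow) simp
    with step[OF \<open>P k (imem s' ''pos'' 0)\<close> k refl] show "wp ?c (\<lambda>m s''. m \<le> 48 \<and> P (Suc k) (imem s'' ''pos'' 0)) s'"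
      by (auto simp: mem j y_def[symmetric] c_def[symmetric] not_less split: if_splits)
  qed (use K len in \<open>auto simp: same_def len_def P_def\<close>)
  then have "wp (for_loop ''j'' (ivar ''K'') ?c) (\<lambda>m s'. 3 + m \<le> 12 + K * 60 \<and>
      0 \<le> imem s' ''pos'' 0 \<and> imem s' ''pos'' 0 \<le> len \<and>
      (\<forall>l. 1 \<le> l \<and> l \<le> imem s' ''pos'' 0 \<longrightarrow> c < y l) \<and>
      (\<forall>l. imem s' ''pos'' 0 < l \<and> l \<le> len \<longrightarrow> y l \<le> c)) ?s"
  proof (rule wp_frame)
    fix m s' assume *: "m \<le> icost (ivar ''K'') + 7 + K * (48 + icost (ivar ''K'') + 10) \<and>
        P K (imem s' ''pos'' 0)"
    note * = *[unfolded P_def]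
    have "c < y l" if "1 \<le> l" "l \<le> imem s' ''pos'' 0" for l
      using * that y[of l "imem s' ''pos'' 0"] by (cases "l = imem s' ''pos'' 0") fastforce+
    then show "3 + m \<le> 12 + K * 60 \<and>
      0 \<le> imem s' ''pos'' 0 \<and> imem s' ''pos'' 0 \<le> len \<and>
      (\<forall>l. 1 \<le> l \<and> l \<le> imem s' ''pos'' 0 \<longrightarrow> c < y l) \<and>
      (\<forall>l. imem s' ''pos'' 0 < l \<and> l \<le> len \<longrightarrow> y l \<le> c)"
      using * by auto
  qed
  then show ?thesis
    by (simp add: search_prog_def y_def len_def c_def)
qed

lemma wp_lis_prog:
  fixes n K :: nat
  assumes n: "imem s ''n'' 0 = int n" and K: "imem s ''K'' 0 = int K" "int n < 2 ^ K"
    and pow: "\<And>j. j < K \<Longrightarrow> imem s ''pow'' (int j) = 2 ^ j"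
    and tail0: "imem s ''tail'' 0 = -1"
  shows "wp lis_prog (\<lambda>m s'. m \<le> 12 + n * (72 + K * 60) \<and>
      lis_inv (rmem s ''x'') (imem s' ''level'') (imem s' ''pred'') (imem s' ''tail'') (imem s' ''len'' 0) (int n)) s"
proof -
  let ?s = "iupdate ''len'' 0 0 s"
  let ?c = "search_prog;;
         IWrite ''level'' (ivar ''p'') (IAdd (ivar ''pos'') (IConst 1));;
         IWrite ''pred'' (ivar ''p'') (IRead ''tail'' (ivar ''pos''));;
         IWrite ''tail'' (IAdd (ivar ''pos'') (IConst 1)) (ivar ''p'');;
         If (ILess (ivar ''len'') (IAdd (ivar ''pos'') (IConst 1)))
           (iset ''len'' (IAdd (ivar ''pos'') (IConst 1))) Skip"
  let ?I = "\<lambda>k s'. lis_inv (rmem s ''x'') (imem s' ''level'') (imem s' ''pred'') (imem s' ''tail'')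
    (imem s' ''len'' 0) (int k)"
  have "wp (for_loop ''p'' (ivar ''n'') ?c) (\<lambda>m s'. m \<le> icost (ivar ''n'') + 7 +
      n * (60 + K * 60 + icost (ivar ''n'') + 10) \<and> ?I n s') ?s"
  proof (rule wp_for_loop[where I = ?I])
    fix k s' assume k: "k < n" and same: "same (insert ''p'' (iwrites ?c)) (rwrites ?c) ?s s'"
      and p: "imem s' ''p'' 0 = int k" and I: "?I k s'"
    have mem: "imem s' ''K'' 0 = int K" "imem s' ''pow'' = imem s ''pow''" "rmem s' ''x'' = rmem s ''x''"
      using same K by (simp_all add: same_def)
    have len: "0 \<le> imem s' ''len'' 0" "imem s' ''len'' 0 \<le> int k"
      using I unfolding lis_inv_def by blast+
    have len_less: "imem s' ''len'' 0 < 2 ^ K"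
      using len(2) k K(2) by linarith
    have strict: "rmem s' ''x'' (imem s' ''tail'' l') < rmem s' ''x'' (imem s' ''tail'' l)"
      if "1 \<le> l" "l < l'" "l' \<le> imem s' ''len'' 0" for l l'
      using I that unfolding lis_inv_def mem by blast
    obtain m1 s1 where 1: "exec search_prog s' m1 s1" "same {''pos'', ''j'', ''q''} {} s' s1" "m1 \<le> 12 + K * 60"
      and pos: "0 \<le> imem s1 ''pos'' 0" "imem s1 ''pos'' 0 \<le> imem s' ''len'' 0"
        "\<And>l. 1 \<le> l \<Longrightarrow> l \<le> imem s1 ''pos'' 0 \<Longrightarrow> rmem s ''x'' (int k) < rmem s ''x'' (imem s' ''tail'' l)"
        "\<And>l. imem s1 ''pos'' 0 < l \<Longrightarrow> l \<le> imem s' ''len'' 0 \<Longrightarrow>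
          rmem s ''x'' (imem s' ''tail'' l) \<le> rmem s ''x'' (int k)"
      by (rule wpE[OF wp_search_prog[OF mem(1) _ len(1) len_less strict]])
        (use mem pow p in auto)
    have mem1: "imem s1 ''p'' 0 = int k" "imem s1 ''tail'' = imem s' ''tail''" "imem s1 ''len'' = imem s' ''len''"
      "imem s1 ''level'' = imem s' ''level''" "imem s1 ''pred'' = imem s' ''pred''"
      using 1(2) p by (simp_all add: same_def)
    have "lis_inv (rmem s ''x'') ((imem s' ''level'')(int k := imem s1 ''pos'' 0 + 1))
        ((imem s' ''pred'')(int k := imem s' ''tail'' (imem s1 ''pos'' 0)))
        ((imem s' ''tail'')(imem s1 ''pos'' 0 + 1 := int k))
        (max (imem s' ''len'' 0) (imem s1 ''pos'' 0 + 1)) (int k + 1)"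
      by (rule lis_inv_step[OF I pos])
    moreover have "max len (pos + 1) = (if len < pos + 1 then pos + 1 else len)" for len pos :: int
      by auto
    ultimately show "wp ?c (\<lambda>m s''. m \<le> 60 + K * 60 \<and> ?I (Suc k) s'') s'"
      using 1(3) by simp (rule wp_exec[OF 1(1)], simp add: mem1 add.commute split: if_splits)
  next
    show "?I 0 ?s"
      using tail0 by (simp add: lis_inv_def)
  qed (use n in \<open>auto simp: same_def\<close>)
  then have "wp (for_loop ''p'' (ivar ''n'') ?c) (\<lambda>m s'. 3 + m \<le> 12 + n * (72 + K * 60) \<and> ?I n s') ?s"
    by (rule wp_frame) simp
  then show ?thesis
    by (simp add: lis_prog_def)
qed

text \<open>Bonuses are written at tuple indices; injectivity of \<open>pi\<close> ensures that a
  new one never overwrites that of a position already treated.\<close>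

lemma wp_output_prog:
  fixes n d :: nat
  assumes n: "imem s ''n'' 0 = int n" and d: "imem s ''d'' 0 = int d"
    and pi: "inj_on (imem s ''pi'') {0..<int n}"
    and lis: "lis_inv (rmem s ''x'') (imem s ''level'') (imem s ''pred'') (imem s ''tail'') (imem s ''len'' 0) (int n)"
  shows "wp output_prog (\<lambda>m s'. m \<le> 50 + d * 20 + n * 80 \<and>
      (\<forall>j<d. rmem s' ''w'' (int j) = rmem s ''u'' (int j)) \<and>
      sweep_inv (rmem s ''x'') (imem s ''level'') (imem s ''len'' 0) (int n) 0
        (\<lambda>q. rmem s' ''v'' (imem s ''pi'' q)) (imem s' ''cur'' 0) (rmem s' ''low'' 0)) s"
proof -
  let ?w = "RWrite ''w'' (ivar ''j'') (RRead ''u'' (ivar ''j''))"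
  let ?c = "iset ''p'' (ISub (ISub (ivar ''n'') (IConst 1)) (ivar ''i''));;
         If (BAnd (BNot (ILess (ivar ''p'') (ivar ''cur''))) (BNot (ILess (ivar ''cur'') (ivar ''p''))))
           (rset ''low'' (RRead ''x'' (ivar ''p''));; iset ''cur'' (IRead ''pred'' (ivar ''p'')))
           (If (ILess (ivar ''cur'') (IConst 0))
              (rset ''low'' (RAdd (rvar ''low'') (RInt (IConst 1))))
              (rset ''low'' (RDiv (RAdd (rvar ''low'') (RRead ''x'' (ivar ''cur''))) (RInt (IConst 2)))));;
         RWrite ''v'' (IRead ''pi'' (ivar ''p'')) (RSub (rvar ''low'') (RRead ''x'' (ivar ''p'')))"
  have "wp (for_loop ''j'' (ivar ''d'') ?w) (\<lambda>m s'. m \<le> icost (ivar ''d'') + 7 +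
      d * (6 + icost (ivar ''d'') + 10) \<and> (\<forall>j<d. rmem s' ''w'' (int j) = rmem s ''u'' (int j))) s"
    by (rule wp_for_loop[where I = "\<lambda>k s'. \<forall>j<k. rmem s' ''w'' (int j) = rmem s ''u'' (int j)"])
      (use d in \<open>auto simp: same_def less_Suc_eq\<close>)
  then obtain m1 s1 where 1: "exec (for_loop ''j'' (ivar ''d'') ?w) s m1 s1" "same {''j''} {''w''} s s1"
    "m1 \<le> 9 + d * 18" "\<forall>j<d. rmem s1 ''w'' (int j) = rmem s ''u'' (int j)"
    by (rule wpE) auto
  let ?cur = "imem s ''tail'' (imem s ''len'' 0)"
  let ?s1 = "rupdate ''low'' 0 (rmem s ''x'' ?cur - 1) (iupdate ''cur'' 0 ?cur s1)"
  let ?I = "\<lambda>k s'. sweep_inv (rmem s ''x'') (imem s ''level'') (imem s ''len'' 0) (int n) (int n - int k)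
        (\<lambda>q. rmem s' ''v'' (imem s ''pi'' q)) (imem s' ''cur'' 0) (rmem s' ''low'' 0)"
  have "wp (for_loop ''i'' (ivar ''n'') ?c) (\<lambda>m s'. m \<le> icost (ivar ''n'') + 7 +
      n * (60 + icost (ivar ''n'') + 10) \<and> ?I n s') ?s1"
  proof (rule wp_for_loop[where I = ?I])
    fix k s' assume k: "k < n" and same: "same (insert ''i'' (iwrites ?c)) (rwrites ?c) ?s1 s'"
      and i: "imem s' ''i'' 0 = int k" and I: "?I k s'"
    define p where "p = int n - 1 - int k"
    define cur where "cur = imem s' ''cur'' 0"
    define low where "low = rmem s' ''low'' 0"
    define low' where "low' = (if cur = p then rmem s ''x'' p else if cur < 0 then low + 1
      else (low + rmem s ''x'' cur) / 2)"
    define cur' where "cur' = (if cur = p then imem s ''pred'' p else cur)"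
    have mem: "imem s' ''n'' 0 = int n" "imem s' ''pred'' = imem s ''pred''" "imem s' ''pi'' = imem s ''pi''"
      "rmem s' ''x'' = rmem s ''x''"
      using same n 1(2) by (simp_all add: same_def)
    have p: "0 \<le> p" "p < int n" "int n - int k = p + 1" "int n - (1 + int k) = p"
      using k by (simp_all add: p_def)
    have I': "sweep_inv (rmem s ''x'') (imem s ''level'') (imem s ''len'' 0) (int n) (p + 1)
        (\<lambda>q. rmem s' ''v'' (imem s ''pi'' q)) cur low"
      using I p by (simp add: cur_def low_def)
    have pi_neq: "imem s ''pi'' q \<noteq> imem s ''pi'' p" if "p < q" "q < int n" for q
      using inj_onD[OF pi, of q p] that p by auto
    have "low < rmem s ''x'' cur" if "0 \<le> cur"
      using I' that by (simp add: sweep_inv_def)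
    then have "sweep_inv (rmem s ''x'') (imem s ''level'') (imem s ''len'' 0) (int n) p
        (\<lambda>q. ((rmem s' ''v'')(imem s ''pi'' p := low' - rmem s ''x'' p)) (imem s ''pi'' q)) cur' low'"
      by (intro sweep_inv_step[OF lis I' p(1,2)])
        (use pi_neq in \<open>auto simp: low'_def cur'_def\<close>)
    then show "wp ?c (\<lambda>m s''. m \<le> 60 \<and> ?I (Suc k) s'') s'"
      using p(3,4)
      by (cases "cur = p"; cases "cur < 0")
        (auto simp: mem i p_def[symmetric] cur_def[symmetric] low_def[symmetric] low'_def cur'_def
          cong: if_cong)
  next
    show "?I 0 ?s1"
      using sweep_inv_init[OF lis] 1(2) by (simp add: same_def)
  qed (use n 1(2) in \<open>auto simp: same_def\<close>)
  then obtain m2 s2 where 2: "exec (for_loop ''i'' (ivar ''n'') ?c) ?s1 m2 s2"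
    "same {''i'', ''cur'', ''p''} {''v'', ''low''} ?s1 s2" "m2 \<le> 9 + n * 72" "?I n s2"
    by (rule wpE) auto
  have "\<forall>j<d. rmem s2 ''w'' (int j) = rmem s ''u'' (int j)"
    using 2(2) 1(4) by (simp add: same_def)
  moreover have "rmem s1 ''x'' = rmem s ''x''" "imem s1 ''tail'' = imem s ''tail''"
    "imem s1 ''len'' = imem s ''len''"
    using 1(2) by (simp_all add: same_def)
  ultimately show ?thesis
    unfolding output_prog_def using 1(3) 2(3,4)
    by simp (rule wp_exec[OF 1(1)], simp, rule wp_exec[OF 2(1)], simp)
qed

section \<open>Enumeration of the candidates\<close>

definition digit :: "nat \<Rightarrow> nat \<Rightarrow> nat \<Rightarrow> nat" where
  "digit n t j = t div n ^ j mod n"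

text \<open>Horner's rule: \<open>f 0 + n * t\<close> puts a new lowest digit below those of t. Thus
  the counter meets every choice of tuple indices.\<close>

lemma ex_digits:
  "(\<And>j. j < m \<Longrightarrow> f j < n) \<Longrightarrow> \<exists>t < n ^ m. \<forall>j<m. digit n t j = f j"
proof (induction m arbitrary: f)
  case (Suc m)
  obtain t where t: "t < n ^ m" "\<And>j. j < m \<Longrightarrow> digit n t j = f (Suc j)"
    using Suc.IH[of "\<lambda>j. f (Suc j)"] Suc.prems by auto
  have f0: "f 0 < n"
    using Suc.prems by simp
  have "f 0 + n * t < n * Suc t"
    using f0 by simp
  also have "\<dots> \<le> n * n ^ m"
    using t(1) by (intro mult_le_mono2) simp
  finally have "f 0 + n * t < n ^ Suc m"
    by simp
  moreover have "digit n (f 0 + n * t) j = f j" if "j < Suc m" for j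
  proof (cases j)
    case 0
    then show ?thesis
      using f0 by (simp add: digit_def)
  next
    case (Suc i)
    then show ?thesis
      using f0 t(2)[of i] that by (simp add: digit_def div_mult2_eq)
  qed
  ultimately show ?case
    by blast
qed simp

text \<open>The digits are advanced like an odometer, since extracting them from the counter would
  need integer division.\<close>

definition increment_prog :: com where
  "increment_prog =
     (iset ''carry'' (IConst 1);;
      for_loop ''j'' (IAdd (ivar ''d'') (ivar ''d''))
        (IWrite ''c'' (ivar ''j'') (IAdd (IRead ''c'' (ivar ''j'')) (ivar ''carry''));;
         If (ILess (IRead ''c'' (ivar ''j'')) (ivar ''n''))
           (iset ''carry'' (IConst 0))
           (IWrite ''c'' (ivar ''j'') (IConst 0))))"

definition count_prog :: com where
  "count_prog =
     (iset ''N'' (IConst 1);;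
      for_loop ''i'' (IAdd (ivar ''d'') (ivar ''d'')) (iset ''N'' (IMul (ivar ''N'') (ivar ''n''))))"

text \<open>Rounds after \<open>pow\<close> has passed n do nothing. Running n rounds anyway keeps
  the loop a counted one, at a cost that is only linear.\<close>

definition power_prog :: com where
  "power_prog =
     (iset ''K'' (IConst 0);;
      iset ''pow'' (IConst 1);;
      for_loop ''i'' (ivar ''n'')
        (If (ILess (ivar ''n'') (IRead ''pow'' (ivar ''K''))) Skip
           (IWrite ''pow'' (IAdd (ivar ''K'') (IConst 1))
              (IAdd (IRead ''pow'' (ivar ''K'')) (IRead ''pow'' (ivar ''K'')));;
            iset ''K'' (IAdd (ivar ''K'') (IConst 1)))))"

lemma writes_count [simp]:
  "iwrites increment_prog = {''carry'', ''j'', ''c''}" "rwrites increment_prog = {}"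
  "iwrites count_prog = {''N'', ''i''}" "rwrites count_prog = {}"
  "iwrites power_prog = {''K'', ''pow'', ''i''}" "rwrites power_prog = {}"
  by (auto simp: increment_prog_def count_prog_def power_prog_def)

text \<open>The carry into digit k is 1 exactly if n ^ k divides t + 1, which is when the quotient
  by n ^ k grows from t to t + 1.\<close>

lemma wp_increment_prog:
  assumes n: "imem s ''n'' 0 = int n" and d: "imem s ''d'' 0 = int d" and pos: "0 < d \<longrightarrow> 0 < n"
    and c: "\<forall>j<2 * d. imem s ''c'' (int j) = int (digit n t j)"
  shows "wp increment_prog (\<lambda>m s'. m \<le> 15 + d * 80 \<and>
      (\<forall>j<2 * d. imem s' ''c'' (int j) = int (digit n (Suc t) j))) s"
proof -
  let ?s = "iupdate ''carry'' 0 1 s"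
  let ?c = "IWrite ''c'' (ivar ''j'') (IAdd (IRead ''c'' (ivar ''j'')) (ivar ''carry''));;
         If (ILess (IRead ''c'' (ivar ''j'')) (ivar ''n''))
           (iset ''carry'' (IConst 0))
           (IWrite ''c'' (ivar ''j'') (IConst 0))"
  let ?I = "\<lambda>k s'. imem s' ''carry'' 0 = (if n ^ k dvd Suc t then 1 else 0) \<and>
      (\<forall>j<2 * d. imem s' ''c'' (int j) = int (digit n (if j < k then Suc t else t) j))"
  have "wp (for_loop ''j'' (IAdd (ivar ''d'') (ivar ''d'')) ?c) (\<lambda>m s'.
      m \<le> icost (IAdd (ivar ''d'') (ivar ''d'')) + 7 +
        (2 * d) * (25 + icost (IAdd (ivar ''d'') (ivar ''d'')) + 10) \<and> ?I (2 * d) s') ?s"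
  proof (rule wp_for_loop[where I = ?I])
    fix k s' assume k: "k < 2 * d" and same: "same (insert ''j'' (iwrites ?c)) (rwrites ?c) ?s s'"
      and j: "imem s' ''j'' 0 = int k" and I: "?I k s'"
    have n0: "0 < n"
      using k pos by auto
    have n': "imem s' ''n'' 0 = int n"
      using same n by (simp add: same_def)
    have ck: "imem s' ''c'' (int k) = int (digit n t k)"
      using I k by simp
    have Suc_div: "Suc t div n ^ k = t div n ^ k + (if n ^ k dvd Suc t then 1 else 0)"
      by (simp add: div_Suc dvd_eq_mod_eq_0)
    have dvd: "n ^ Suc k dvd Suc t \<longleftrightarrow> n ^ k dvd Suc t \<and> n dvd (Suc t div n ^ k)"
      using n0 by (metis dvd_div_iff_mult dvd_mult_left mult.commute power_Suc power_not_zero not_gr_zero)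
    show "wp ?c (\<lambda>m s''. m \<le> 25 \<and> ?I (Suc k) s'') s'"
    proof (cases "n ^ k dvd Suc t")
      case True
      have new: "digit n (Suc t) k = (digit n t k + 1) mod n"
        using True Suc_div by (simp add: digit_def mod_Suc_eq)
      have dvd': "n ^ Suc k dvd Suc t \<longleftrightarrow> digit n (Suc t) k = 0"
        using True dvd by (simp add: digit_def dvd_eq_mod_eq_0)
      show ?thesis
      proof (cases "digit n t k + 1 < n")
        case True2: True
        then have "digit n (Suc t) k = digit n t k + 1"
          using new by simp
        then show ?thesis
          using True True2 I ck j n' dvd' by (auto simp: less_Suc_eq)
      next
        case False
        moreover have "digit n t k < n"
          using n0 by (simp add: digit_def)
        ultimately have eq: "digit n t k + 1 = n"
          by simp
        then have "digit n (Suc t) k = 0"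
          using new by simp
        then show ?thesis
          using True eq I ck j n' dvd' by (auto simp: less_Suc_eq)
      qed
    next
      case False
      have new: "digit n (Suc t) k = digit n t k"
        using False Suc_div by (simp add: digit_def)
      have "digit n t k < n"
        using n0 by (simp add: digit_def)
      then show ?thesis
        using False I ck j n' dvd new by (auto simp: less_Suc_eq)
    qed
  qed (use d c in \<open>auto simp: same_def\<close>)
  then have "wp (for_loop ''j'' (IAdd (ivar ''d'') (ivar ''d'')) ?c) (\<lambda>m s'. 3 + m \<le> 15 + d * 80 \<and>
      (\<forall>j<2 * d. imem s' ''c'' (int j) = int (digit n (Suc t) j))) ?s"
    by (rule wp_frame) auto
  then show ?thesis
    by (simp add: increment_prog_def)
qed

lemma wp_count_prog:
  assumes "imem s ''n'' 0 = int n" "imem s ''d'' 0 = int d"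
  shows "wp count_prog (\<lambda>m s'. m \<le> 15 + d * 50 \<and> imem s' ''N'' 0 = int (n ^ (2 * d))) s"
proof -
  let ?c = "iset ''N'' (IMul (ivar ''N'') (ivar ''n''))"
  have "wp (for_loop ''i'' (IAdd (ivar ''d'') (ivar ''d'')) ?c) (\<lambda>m s'.
      m \<le> icost (IAdd (ivar ''d'') (ivar ''d'')) + 7 +
        (2 * d) * (7 + icost (IAdd (ivar ''d'') (ivar ''d'')) + 10) \<and> imem s' ''N'' 0 = int (n ^ (2 * d)))
      (iupdate ''N'' 0 1 s)"
    by (rule wp_for_loop[where I = "\<lambda>k s'. imem s' ''N'' 0 = int (n ^ k)"])
      (use assms in \<open>auto simp: same_def\<close>)
  then have "wp (for_loop ''i'' (IAdd (ivar ''d'') (ivar ''d'')) ?c) (\<lambda>m s'.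
      3 + m \<le> 15 + d * 50 \<and> imem s' ''N'' 0 = int (n ^ (2 * d))) (iupdate ''N'' 0 1 s)"
    by (rule wp_frame) auto
  then show ?thesis
    by (simp add: count_prog_def)
qed

text \<open>For positive n this is the number of binary digits of n; it bounds the rounds of one
  binary search.\<close>

definition lg :: "nat \<Rightarrow> nat" where
  "lg n = Suc (nat \<lfloor>log 2 (real n)\<rfloor>)"

lemma le_lg: "2 ^ K \<le> 2 * n \<Longrightarrow> K \<le> lg n"
proof (cases K)
  case (Suc i)
  assume "2 ^ K \<le> 2 * n"
  then have "2 ^ i \<le> n"
    using Suc by simp
  then have "real i \<le> log 2 (real n)"
    by (rule le_log2_of_power)
  then have "i \<le> nat \<lfloor>log 2 (real n)\<rfloor>"
    by (simp add: le_nat_floor)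
  then show ?thesis
    using Suc by (simp add: lg_def)
qed simp

lemma wp_power_prog:
  assumes n: "imem s ''n'' 0 = int n"
  shows "wp power_prog (\<lambda>m s'. m \<le> 15 + n * 50 \<and> (\<exists>K. imem s' ''K'' 0 = int K \<and> n < 2 ^ K \<and> K \<le> lg n \<and>
      (\<forall>j<K. imem s' ''pow'' (int j) = 2 ^ j))) s"
proof -
  let ?s = "iupdate ''pow'' 0 1 (iupdate ''K'' 0 0 s)"
  let ?c = "If (ILess (ivar ''n'') (IRead ''pow'' (ivar ''K''))) Skip
           (IWrite ''pow'' (IAdd (ivar ''K'') (IConst 1))
              (IAdd (IRead ''pow'' (ivar ''K'')) (IRead ''pow'' (ivar ''K'')));;
            iset ''K'' (IAdd (ivar ''K'') (IConst 1)))"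
  \<comment> \<open>While \<open>2 ^ K\<close> is at most n, every round so far has doubled, so K =
    k. At k = n this would mean \<open>2 ^ n\<close> at most n, which is impossible.\<close>
  let ?I = "\<lambda>k s'. \<exists>K. imem s' ''K'' 0 = int K \<and> (\<forall>j\<le>K. imem s' ''pow'' (int j) = 2 ^ j) \<and>
      (2 ^ K \<le> n \<longrightarrow> K = k) \<and> K \<le> lg n"
  have "wp (for_loop ''i'' (ivar ''n'') ?c) (\<lambda>m s'. m \<le> icost (ivar ''n'') + 7 +
      n * (35 + icost (ivar ''n'') + 10) \<and> ?I n s') ?s"
  proof (rule wp_for_loop[where I = ?I])
    fix k s' assume k: "k < n" and same: "same (insert ''i'' (iwrites ?c)) (rwrites ?c) ?s s'" and I: "?I k s'"
    obtain K where K: "imem s' ''K'' 0 = int K" "\<forall>j\<le>K. imem s' ''pow'' (int j) = 2 ^ j"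
      "2 ^ K \<le> n \<longrightarrow> K = k" "K \<le> lg n"
      using I by blast
    have n': "imem s' ''n'' 0 = int n"
      using same n by (simp add: same_def)
    have less: "int n < 2 ^ K \<longleftrightarrow> \<not> 2 ^ K \<le> n"
      by (metis not_le of_nat_less_iff of_nat_numeral of_nat_power)
    show "wp ?c (\<lambda>m s''. m \<le> 35 \<and> ?I (Suc k) s'') s'"
    proof (cases "2 ^ K \<le> n")
      case True
      then have lg: "Suc K \<le> lg n"
        by (intro le_lg) simp
      define s'' where
        "s'' = iupdate ''K'' 0 (int K + 1) (iupdate ''pow'' (int K + 1) (2 ^ K + 2 ^ K) s')"
      have "imem s'' ''K'' 0 = int (Suc K)" "\<forall>j\<le>Suc K. imem s'' ''pow'' (int j) = 2 ^ j"
        using K(2) by (auto simp: le_Suc_eq s''_def)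
      moreover have "2 ^ Suc K \<le> n \<longrightarrow> Suc K = Suc k"
        using True K(3) by simp
      ultimately have "?I (Suc k) s''"
        using lg by blast
      moreover have "wp ?c (\<lambda>m s2. m \<le> 35 \<and> s2 = s'') s'"
        using True K less n' by (simp add: s''_def)
      ultimately show ?thesis
        by (elim wp_frame) blast
    next
      case False
      then have "?I (Suc k) s'"
        using K by blast
      moreover have "wp ?c (\<lambda>m s2. m \<le> 35 \<and> s2 = s') s'"
        using False K less n' by simp
      ultimately show ?thesis
        by (elim wp_frame) blast
    qed
  next
    show "?I 0 ?s"
      by (rule exI[of _ 0]) simp
  qed (use n in \<open>auto simp: same_def\<close>)
  then have "wp (for_loop ''i'' (ivar ''n'') ?c) (\<lambda>m s'. 6 + m \<le> 15 + n * 50 \<and>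
      (\<exists>K. imem s' ''K'' 0 = int K \<and> n < 2 ^ K \<and> K \<le> lg n \<and> (\<forall>j<K. imem s' ''pow'' (int j) = 2 ^ j))) ?s"
  proof (rule wp_frame)
    fix m s' assume *: "m \<le> icost (ivar ''n'') + 7 + n * (35 + icost (ivar ''n'') + 10) \<and> ?I n s'"
    then obtain K where K: "imem s' ''K'' 0 = int K" "\<forall>j\<le>K. imem s' ''pow'' (int j) = 2 ^ j"
      "2 ^ K \<le> n \<longrightarrow> K = n" "K \<le> lg n"
      by blast
    have "n < 2 ^ K"
      using K(3) less_exp[of n] by (cases "2 ^ K \<le> n") auto
    then show "6 + m \<le> 15 + n * 50 \<and>
      (\<exists>K. imem s' ''K'' 0 = int K \<and> n < 2 ^ K \<and> K \<le> lg n \<and> (\<forall>j<K. imem s' ''pow'' (int j) = 2 ^ j))"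
      using * K by auto
  qed
  then show ?thesis
    by (simp add: power_prog_def)
qed

section \<open>One candidate, and the loop over all candidates\<close>

definition body_prog :: com where
  "body_prog =
     (solve_prog;; score_prog;; lis_prog;;
      If (ILess (IAdd (ivar ''len'') (ivar ''k'')) (ivar ''n'')) Skip output_prog;;
      increment_prog)"

definition main_prog :: com where
  "main_prog =
     (count_prog;; power_prog;; iset ''tail'' (IConst (-1));; for_loop ''t'' (ivar ''N'') body_prog)"

definition body_time :: "nat \<Rightarrow> nat \<Rightarrow> nat" where
  "body_time d n = solve_time d + 200 + d * 100 + n * (200 + d * 38) + n * (lg n * 60)"

definition main_time :: "nat \<Rightarrow> nat \<Rightarrow> nat" where
  "main_time d n = 100 + d * 50 + n * 50 + n ^ (2 * d) * (12 + body_time d n)"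

text \<open>Unlike \<open>input_state\<close> this leaves the work arrays open, so it persists
  through the loop.\<close>

definition holds_input :: "nat \<Rightarrow> real vec list \<Rightarrow> nat list \<Rightarrow> int \<Rightarrow> state \<Rightarrow> bool" where
  "holds_input d D \<pi> k s \<longleftrightarrow>
     imem s ''n'' 0 = int (length D) \<and> imem s ''d'' 0 = int d \<and> imem s ''k'' 0 = k \<and>
     (\<forall>p<length D. imem s ''pi'' (int p) = int (\<pi> ! p)) \<and>
     (\<forall>i<length D. \<forall>j<d. rmem s ''D'' (int i * int d + int j) = D ! i $ j)"

lemma holds_input_same:
  "holds_input d D \<pi> k s \<Longrightarrow> same W R s s' \<Longrightarrow> {''n'', ''d'', ''k'', ''pi''} \<inter> W = {} \<Longrightarrow> ''D'' \<notin> R \<Longrightarrow>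
     holds_input d D \<pi> k s'"
  by (simp add: holds_input_def same_def)

lemma holds_input_input_state: "holds_input d D \<pi> k (input_state d D \<pi> k)"
proof -
  have "nat (int i * int d + int j) div d = i" "nat (int i * int d + int j) mod d = j"
    if "j < d" for i j
    using that by (simp_all add: nat_add_distrib nat_mult_distrib)
  then show ?thesis
    by (auto simp: holds_input_def input_state_def row_index_less)
qed

section \<open>Completeness and soundness of the candidates\<close>

definition candidate_row :: "real vec list \<Rightarrow> nat \<Rightarrow> nat \<Rightarrow> nat \<Rightarrow> real" where
  "candidate_row D t i j =
     D ! digit (length D) t (2 * i) $ j - D ! digit (length D) t (2 * i + 1) $ j"

definition score :: "nat \<Rightarrow> real vec list \<Rightarrow> nat list \<Rightarrow> nat \<Rightarrow> nat \<Rightarrow> real" where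
  "score d D \<pi> t p = dot d (solve_ones d (candidate_row D t) d) (\<lambda>j. D ! (\<pi> ! p) $ j)"

text \<open>\<open>A\<close> collects positions that keep bonus 0. The size bound is taken over the
  integers, so a negative k rules out every candidate.\<close>

definition good :: "nat \<Rightarrow> real vec list \<Rightarrow> nat list \<Rightarrow> int \<Rightarrow> nat \<Rightarrow> bool" where
  "good d D \<pi> k t \<longleftrightarrow> (\<exists>A \<subseteq> {..<length D}. int (length D) \<le> int (card A) + k \<and>
     (\<forall>p\<in>A. \<forall>q\<in>A. p < q \<longrightarrow> score d D \<pi> t q < score d D \<pi> t p))"

lemma bij_betw_ranking: "ranking D \<pi> \<Longrightarrow> bij_betw (nth \<pi>) {..<length D} {..<length D}"
  unfolding ranking_def by (metis bij_betw_nth card_lessThan distinct_card)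

text \<open>Bonuses are counted over tuple indices, subsequences over positions; the permutation
  translates one count into the other.\<close>

lemma card_ranking:
  assumes "ranking D \<pi>"
  shows "card {i. i < length D \<and> P i} = card {p \<in> {..<length D}. P (\<pi> ! p)}"
proof -
  have "bij_betw (nth \<pi>) {p \<in> {..<length D}. P (\<pi> ! p)} {i. i < length D \<and> P i}"
    using bij_betw_ranking[OF assms] unfolding bij_betw_def inj_on_def by auto
  then show ?thesis
    by (rule bij_betw_same_card[symmetric])
qed

lemma length_ranking: "ranking D \<pi> \<Longrightarrow> length \<pi> = length D"
  unfolding ranking_def by (metis card_lessThan distinct_card)

lemma sorting_produces_iff:
  assumes "ranking D \<pi>"
  shows "sorting_produces d D w v \<pi> \<longleftrightarrow> (\<forall>p q. p < q \<and> q < length D \<longrightarrow>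
    utility d w (D ! (\<pi> ! q)) + v $ (\<pi> ! q) < utility d w (D ! (\<pi> ! p)) + v $ (\<pi> ! p))"
  using length_ranking[OF assms] by (auto simp: sorting_produces_def sorted_wrt_iff_nth_less)

text \<open>On the positions without bonus the weights w of the given solution already order the
  tuples strictly. The minimal face argument for these differences replaces w by a vector among the
  candidates.\<close>

lemma ex_good:
  assumes rank: "ranking D \<pi>" and sol: "satisfying_solution d D \<pi> k w v"
    and pos: "0 < d \<longrightarrow> 0 < length D"
  shows "\<exists>t < length D ^ (2 * d). good d D \<pi> k t"
proof -
  let ?n = "length D"
  define A where "A = {p \<in> {..<?n}. v $ (\<pi> ! p) = 0}"
  define row where "row i = (\<lambda>j. D ! i $ j)" for i
  define S where "S = (\<lambda>(p, q). \<lambda>j. row (\<pi> ! p) j - row (\<pi> ! q) j) ` {(p, q). p \<in> A \<and> q \<in> A \<and> p < q}"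
  have \<pi>: "\<pi> ! p < ?n" if "p < ?n" for p
    using bij_betw_ranking[OF rank] that by (auto simp: bij_betw_def)
  have "finite {(p, q). p \<in> A \<and> q \<in> A \<and> p < q}"
    by (rule finite_subset[of _ "A \<times> A"]) (auto simp: A_def)
  then have "finite S"
    by (simp add: S_def)
  moreover have "0 < dot d s (\<lambda>j. w $ j)" if "s \<in> S" for s
  proof -
    obtain p q where pq: "p \<in> A" "q \<in> A" "p < q" "s = (\<lambda>j. row (\<pi> ! p) j - row (\<pi> ! q) j)"
      using \<open>s \<in> S\<close> by (auto simp: S_def)
    have "utility d w (D ! (\<pi> ! q)) < utility d w (D ! (\<pi> ! p))"
      using sol pq unfolding satisfying_solution_def sorting_produces_iff[OF rank] A_def by force
    then show ?thesis
      unfolding pq(4) dot_diff_left by (simp add: dot_def utility_def row_def mult.commute)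
  qed
  ultimately have "\<exists>a. (\<forall>i<d. a i \<in> S \<or> a i = (\<lambda>j. 0)) \<and> (\<forall>s\<in>S. 0 < dot d s (solve_ones d a d))"
    by (rule ex_rows_solve_ones_pos)
  then obtain a where a: "\<And>i. i < d \<Longrightarrow> a i \<in> S \<or> a i = (\<lambda>j. 0)"
    "\<And>s. s \<in> S \<Longrightarrow> 0 < dot d s (solve_ones d a d)"
    by blast
  have "\<exists>f g. f < ?n \<and> g < ?n \<and> a i = (\<lambda>j. row f j - row g j)" if "i < d" for i
    using a(1)[OF that]
  proof
    assume "a i \<in> S"
    then obtain p q where "p \<in> A" "q \<in> A" "a i = (\<lambda>j. row (\<pi> ! p) j - row (\<pi> ! q) j)"
      by (auto simp: S_def)
    then show ?thesis
      using \<pi> unfolding A_def by blast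
  next
    \<comment> \<open>The zero row is tuple 0 paired with itself; as d is positive here, there is a
      tuple 0.\<close>
    assume "a i = (\<lambda>j. 0)"
    then show ?thesis
      using pos that by (intro exI[of _ 0]) simp
  qed
  then obtain f g where fg: "\<And>i. i < d \<Longrightarrow> f i < ?n \<and> g i < ?n \<and> a i = (\<lambda>j. row (f i) j - row (g i) j)"
    by metis
  \<comment> \<open>The two tuples of each pair are interleaved, matching the digits 2i and 2i + 1
    read by \<open>candidate_row\<close>.\<close>
  define h where "h j = (if even j then f (j div 2) else g (j div 2))" for j
  have "\<exists>t < ?n ^ (2 * d). \<forall>j<2 * d. digit ?n t j = h j"
    by (rule ex_digits) (use fg in \<open>auto simp: h_def\<close>)
  then obtain t where t: "t < ?n ^ (2 * d)" "\<And>j. j < 2 * d \<Longrightarrow> digit ?n t j = h j"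
    by blast
  have "candidate_row D t i = a i" if "i < d" for i
    using fg[OF that] t(2)[of "2 * i"] t(2)[of "2 * i + 1"] that
    by (simp add: fun_eq_iff candidate_row_def h_def row_def)
  then have solve: "solve_ones d (candidate_row D t) d = solve_ones d a d"
    by (rule solve_ones_cong)
  have "score d D \<pi> t q < score d D \<pi> t p" if "p \<in> A" "q \<in> A" "p < q" for p q
  proof -
    have "(\<lambda>j. row (\<pi> ! p) j - row (\<pi> ! q) j) \<in> S"
      using that by (auto simp: S_def)
    from a(2)[OF this] show ?thesis
      unfolding dot_diff_left by (simp add: score_def solve dot_commute[of d "solve_ones d a d"] row_def)
  qed
  moreover have "int ?n \<le> int (card A) + k"
  proof -
    have "{..<?n} = A \<union> {p \<in> {..<?n}. v $ (\<pi> ! p) \<noteq> 0}"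
      by (auto simp: A_def)
    then have "?n = card (A \<union> {p \<in> {..<?n}. v $ (\<pi> ! p) \<noteq> 0})"
      by (metis card_lessThan)
    also have "\<dots> \<le> card A + card {p \<in> {..<?n}. v $ (\<pi> ! p) \<noteq> 0}"
      by (rule card_Un_le)
    also have "\<dots> = card A + card {i. i < ?n \<and> v $ i \<noteq> 0}"
      by (simp only: card_ranking[OF rank])
    finally show ?thesis
      using sol by (simp add: satisfying_solution_def)
  qed
  ultimately have "good d D \<pi> k t"
    unfolding good_def by (intro exI[of _ A]) (auto simp: A_def)
  then show ?thesis
    using t(1) by blast
qed

lemma sweep_satisfying_solution:
  assumes rank: "ranking D \<pi>"
    and x: "\<And>p. p < length D \<Longrightarrow> x (int p) = utility d (output_weights d s) (D ! (\<pi> ! p))"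
    and pi: "\<And>p. p < length D \<Longrightarrow> idx (int p) = int (\<pi> ! p)"
    and sweep: "sweep_inv x level len (int (length D)) 0 (\<lambda>q. rmem s ''v'' (idx q)) cur low"
    and k: "int (length D) \<le> len + k"
  shows "satisfying_solution d D \<pi> k (output_weights d s) (output_bonuses (length D) s)"
proof -
  let ?n = "length D"
  have \<pi>: "\<pi> ! p < ?n" if "p < ?n" for p
    using bij_betw_ranking[OF rank] that by (auto simp: bij_betw_def)
  have v: "rmem s ''v'' (idx (int p)) = output_bonuses ?n s $ (\<pi> ! p)" if "p < ?n" for p
    using \<pi>[OF that] pi[OF that] by (simp add: output_bonuses_def)
  have "sorting_produces d D (output_weights d s) (output_bonuses ?n s) \<pi>"
    unfolding sorting_produces_iff[OF rank]
  proof (intro allI impI)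
    fix p q assume pq: "p < q \<and> q < ?n"
    then have "x (int q) + rmem s ''v'' (idx (int q)) < x (int p) + rmem s ''v'' (idx (int p))"
      using sweep unfolding sweep_inv_def by simp
    then show "utility d (output_weights d s) (D ! (\<pi> ! q)) + output_bonuses ?n s $ (\<pi> ! q)
        < utility d (output_weights d s) (D ! (\<pi> ! p)) + output_bonuses ?n s $ (\<pi> ! p)"
      using pq x[of p] x[of q] v[of p] v[of q] by simp
  qed
  moreover have "int (card {i. i < ?n \<and> output_bonuses ?n s $ i \<noteq> 0}) \<le> k"
  proof -
    have "int ` {p \<in> {..<?n}. output_bonuses ?n s $ (\<pi> ! p) \<noteq> 0} = {q \<in> {0..<int ?n}. rmem s ''v'' (idx q) \<noteq> 0}"
    proof (intro equalityI subsetI)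
      fix q assume q: "q \<in> {q \<in> {0..<int ?n}. rmem s ''v'' (idx q) \<noteq> 0}"
      then have "q = int (nat q)" "nat q < ?n"
        by auto
      then show "q \<in> int ` {p \<in> {..<?n}. output_bonuses ?n s $ (\<pi> ! p) \<noteq> 0}"
        using q v[of "nat q"] by (intro image_eqI[of _ _ "nat q"]) auto
    qed (use v in auto)
    moreover have "card (int ` X) = card X" for X
      by (simp add: card_image)
    ultimately have "card {p \<in> {..<?n}. output_bonuses ?n s $ (\<pi> ! p) \<noteq> 0} =
        card {q \<in> {0..<int ?n}. rmem s ''v'' (idx q) \<noteq> 0}"
      by metis
    \<comment> \<open>At position 0 the bounds on \<open>cur\<close> leave only -1: the whole chain
      has been used, and the counting clause becomes at most n - \<open>len\<close> bonuses.\<close>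
    moreover have "cur < 0" "int (card {q \<in> {0..<int ?n}. rmem s ''v'' (idx q) \<noteq> 0}) + len \<le>
        int ?n - 0 + (if cur < 0 then 0 else level cur)"
      using sweep unfolding sweep_inv_def by blast+
    ultimately show ?thesis
      using k unfolding card_ranking[OF rank] by simp
  qed
  ultimately show ?thesis
    by (simp add: satisfying_solution_def output_weights_def output_bonuses_def)
qed

lemma writes_body [simp]:
  "iwrites body_prog = {''r'', ''row1'', ''row2'', ''i'', ''j'', ''p'', ''len'', ''pos'', ''q'', ''level'',
     ''pred'', ''tail'', ''cur'', ''carry'', ''c''}"
  "rwrites body_prog = {''a'', ''z'', ''acc'', ''fac'', ''b'', ''u'', ''x'', ''w'', ''low'', ''v''}"
  by (auto simp: body_prog_def)

text \<open>A solution found earlier is preserved: a failing candidate leaves \<open>w\<close> and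
  \<open>v\<close> untouched, and a successful one replaces them by another solution.\<close>

lemma wp_body_prog:
  fixes K :: nat
  assumes rank: "ranking D \<pi>" and inp: "holds_input d D \<pi> k s" and pos: "0 < d \<longrightarrow> 0 < length D"
    and K: "imem s ''K'' 0 = int K" "length D < 2 ^ K" "K \<le> lg (length D)"
      "\<forall>j<K. imem s ''pow'' (int j) = 2 ^ j"
    and tail: "imem s ''tail'' 0 = -1"
    and c: "\<forall>j<2 * d. imem s ''c'' (int j) = int (digit (length D) t j)"
  shows "wp body_prog (\<lambda>m s'. m \<le> body_time d (length D) \<and> imem s' ''tail'' 0 = -1 \<and>
      (\<forall>j<2 * d. imem s' ''c'' (int j) = int (digit (length D) (Suc t) j)) \<and>
      (good d D \<pi> k t \<or> satisfying_solution d D \<pi> k (output_weights d s) (output_bonuses (length D) s) \<longrightarrow>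
         satisfying_solution d D \<pi> k (output_weights d s') (output_bonuses (length D) s'))) s"
proof -
  let ?n = "length D"
  let ?sat = "\<lambda>s. satisfying_solution d D \<pi> k (output_weights d s) (output_bonuses ?n s)"
  have inp': "imem s ''n'' 0 = int ?n" "imem s ''d'' 0 = int d" "imem s ''k'' 0 = k"
    "\<And>p. p < ?n \<Longrightarrow> imem s ''pi'' (int p) = int (\<pi> ! p)"
    "\<And>i j. i < ?n \<Longrightarrow> j < d \<Longrightarrow> rmem s ''D'' (int i * int d + int j) = D ! i $ j"
    using inp by (auto simp: holds_input_def)
  have \<pi>: "\<pi> ! p < ?n" if "p < ?n" for p
    using bij_betw_ranking[OF rank] that by (auto simp: bij_betw_def)
  have digit: "digit ?n t j < ?n" if "j < 2 * d" for j
    using that pos by (simp add: digit_def)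
  have row: "rmem s ''D'' (imem s ''c'' (int j) * int d + int l) = D ! digit ?n t j $ l"
    if "j < 2 * d" "l < d" for j l
    using c inp'(5)[of "digit ?n t j" l] digit that by simp
  obtain m1 s1 where 1: "exec solve_prog s m1 s1"
    "same {''r'', ''row1'', ''row2'', ''i'', ''j''} {''a'', ''z'', ''acc'', ''fac'', ''b'', ''u''} s s1"
    "m1 \<le> solve_time d" "\<forall>j<d. rmem s1 ''u'' (int j) = solve_ones d (candidate_row D t) d j"
  proof (rule wpE[OF wp_solve_prog[of s d "candidate_row D t"]])
    show "imem s ''d'' 0 = int d"
      by (fact inp'(2))
    show "rmem s ''D'' (imem s ''c'' (int (2 * i)) * int d + int j) -
        rmem s ''D'' (imem s ''c'' (int (2 * i + 1)) * int d + int j) = candidate_row D t i j"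
      if "i < d" "j < d" for i j
      using row[of "2 * i" j] row[of "2 * i + 1" j] that by (simp add: candidate_row_def)
  qed auto
  have mem1: "imem s1 ''d'' 0 = int d" "imem s1 ''n'' 0 = int ?n" "imem s1 ''pi'' = imem s ''pi''"
    "rmem s1 ''D'' = rmem s ''D''"
    using 1(2) inp' by (simp_all add: same_def)
  obtain m2 s2 where 2: "exec score_prog s1 m2 s2" "same {''p'', ''j''} {''acc'', ''x''} s1 s2"
    "m2 \<le> 9 + ?n * (40 + d * 38)"
    "\<forall>p<?n. rmem s2 ''x'' (int p) = dot d (\<lambda>j. rmem s1 ''u'' (int j))
         (\<lambda>j. rmem s1 ''D'' (imem s1 ''pi'' (int p) * int d + int j))"
    by (rule wpE[OF wp_score_prog[OF mem1(1,2)]]) auto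
  have x: "rmem s2 ''x'' (int p) = score d D \<pi> t p" if "p < ?n" for p
    using 2(4) that 1(4) mem1 inp'(4,5) \<pi>[OF that] by (auto simp: score_def intro: dot_cong)
  have mem2: "imem s2 ''n'' 0 = int ?n" "imem s2 ''K'' 0 = int K" "imem s2 ''pow'' = imem s ''pow''"
    "imem s2 ''tail'' 0 = -1" "imem s2 ''d'' 0 = int d" "imem s2 ''pi'' = imem s ''pi''"
    "imem s2 ''k'' 0 = k" "imem s2 ''c'' = imem s ''c''" "rmem s2 ''u'' = rmem s1 ''u''"
    "rmem s2 ''w'' = rmem s ''w''" "rmem s2 ''v'' = rmem s ''v''"
    using 2(2) 1(2) inp' K tail by (simp_all add: same_def)
  have "int ?n < 2 ^ K"
    using K(2) by (metis of_nat_less_iff of_nat_numeral of_nat_power)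
  then obtain m3 s3 where 3: "exec lis_prog s2 m3 s3"
    "same {''len'', ''p'', ''pos'', ''j'', ''q'', ''level'', ''pred'', ''tail''} {} s2 s3"
    "m3 \<le> 12 + ?n * (72 + K * 60)"
    "lis_inv (rmem s2 ''x'') (imem s3 ''level'') (imem s3 ''pred'') (imem s3 ''tail'') (imem s3 ''len'' 0) (int ?n)"
    using mem2 K(4) by - (rule wpE[OF wp_lis_prog[of s2 ?n K]], auto)
  have mem3: "imem s3 ''n'' 0 = int ?n" "imem s3 ''d'' 0 = int d" "imem s3 ''pi'' = imem s ''pi''"
    "imem s3 ''k'' 0 = k" "imem s3 ''c'' = imem s ''c''" "rmem s3 = rmem s2"
    using 3(2) mem2 by (auto simp: same_def)
  have tail3: "imem s3 ''tail'' 0 = -1"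
    using 3(4) by (simp add: lis_inv_def)
  have good_le: "int ?n \<le> imem s3 ''len'' 0 + k" if "good d D \<pi> k t"
  proof -
    obtain A where A: "A \<subseteq> {..<?n}" "int ?n \<le> int (card A) + k"
      "\<And>p q. p \<in> A \<Longrightarrow> q \<in> A \<Longrightarrow> p < q \<Longrightarrow> score d D \<pi> t q < score d D \<pi> t p"
      using \<open>good d D \<pi> k t\<close> unfolding good_def by blast
    have "int (card (int ` A)) \<le> imem s3 ''len'' 0"
    proof (rule lis_inv_card_le[OF 3(4)])
      show "int ` A \<subseteq> {0..<int ?n}"
        using A(1) by auto
      show "rmem s2 ''x'' q' < rmem s2 ''x'' q" if "q \<in> int ` A" "q' \<in> int ` A" "q < q'" for q q'
        using that A(1,3) x by auto
    qed
    then show ?thesis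
      using A(2) by (simp add: card_image)
  qed
  let ?out = "If (ILess (IAdd (ivar ''len'') (ivar ''k'')) (ivar ''n'')) Skip output_prog"
  have "wp ?out (\<lambda>m s'. m \<le> 60 + d * 20 + ?n * 80 \<and> (good d D \<pi> k t \<or> ?sat s \<longrightarrow> ?sat s')) s3"
  proof (cases "imem s3 ''len'' 0 + k < int ?n")
    case True
    have "?sat s3 = ?sat s"
      by (simp add: output_weights_def output_bonuses_def mem3 mem2)
    moreover have "\<not> good d D \<pi> k t"
      using True good_le by linarith
    ultimately have "good d D \<pi> k t \<or> ?sat s \<longrightarrow> ?sat s3"
      by blast
    then show ?thesis
      using True mem3(1,4) by simp
  next
    case False
    have "inj_on (imem s ''pi'') {0..<int ?n}"
    proof (rule inj_onI)
      fix p q assume pq: "p \<in> {0..<int ?n}" "q \<in> {0..<int ?n}" "imem s ''pi'' p = imem s ''pi'' q"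
      then have "\<pi> ! nat p = \<pi> ! nat q"
        using inp'(4)[of "nat p"] inp'(4)[of "nat q"] by auto
      then have "nat p = nat q"
        using bij_betw_ranking[OF rank] pq unfolding bij_betw_def inj_on_def by auto
      then show "p = q"
        using pq by auto
    qed
    then obtain m4 s4 where 4: "exec output_prog s3 m4 s4" "m4 \<le> 50 + d * 20 + ?n * 80"
      "\<forall>j<d. rmem s4 ''w'' (int j) = rmem s3 ''u'' (int j)"
      "sweep_inv (rmem s3 ''x'') (imem s3 ''level'') (imem s3 ''len'' 0) (int ?n) 0
        (\<lambda>q. rmem s4 ''v'' (imem s3 ''pi'' q)) (imem s4 ''cur'' 0) (rmem s4 ''low'' 0)"
      using mem3 3(4) by - (rule wpE[OF wp_output_prog[of s3 ?n d]], auto)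
    have "?sat s4"
    proof (rule sweep_satisfying_solution[OF rank _ _ 4(4)])
      fix p assume p: "p < ?n"
      show "imem s3 ''pi'' (int p) = int (\<pi> ! p)"
        using p mem3 inp'(4) by simp
      show "rmem s3 ''x'' (int p) = utility d (output_weights d s4) (D ! (\<pi> ! p))"
        using x[OF p] 4(3) 1(4) mem3 mem2 by (simp add: score_def dot_def utility_def output_weights_def)
    qed (use False in simp)
    then show ?thesis
      using False mem3 4(2) by simp (rule wp_exec[OF 4(1)], simp)
  qed
  then obtain m4 s4 where 4: "exec ?out s3 m4 s4" "same {''j'', ''cur'', ''i'', ''p''} {''w'', ''low'', ''v''} s3 s4"
    "m4 \<le> 60 + d * 20 + ?n * 80" "good d D \<pi> k t \<or> ?sat s \<longrightarrow> ?sat s4"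
    by (rule wpE) auto
  have mem4: "imem s4 ''n'' 0 = int ?n" "imem s4 ''d'' 0 = int d" "imem s4 ''tail'' 0 = -1"
    "imem s4 ''c'' = imem s ''c''"
    using 4(2) mem3 tail3 by (simp_all add: same_def)
  obtain m5 s5 where 5: "exec increment_prog s4 m5 s5" "same {''carry'', ''j'', ''c''} {} s4 s5"
    "m5 \<le> 15 + d * 80" "\<forall>j<2 * d. imem s5 ''c'' (int j) = int (digit ?n (Suc t) j)"
    using c mem4(4) by - (rule wpE[OF wp_increment_prog[OF mem4(1,2) pos, of t]], auto)
  have sat5: "?sat s5 = ?sat s4"
    using 5(2) by (simp add: output_weights_def output_bonuses_def same_def)
  have tail5: "imem s5 ''tail'' 0 = -1"
    using 5(2) mem4 by (simp add: same_def)
  have "?n * (K * 60) \<le> ?n * (lg ?n * 60)"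
    using K(3) by simp
  then have "m1 + (m2 + (m3 + (m4 + m5))) \<le> body_time d ?n"
    using 1(3) 2(3) 3(3) 4(3) 5(3) unfolding body_time_def distrib_left by linarith
  moreover have "good d D \<pi> k t \<or> ?sat s \<longrightarrow> ?sat s5"
    using 4(4) sat5 by blast
  ultimately show ?thesis
    unfolding body_prog_def wp_Seq using 5(4) tail5
    by - (rule wp_exec[OF 1(1)], rule wp_exec[OF 2(1)], rule wp_exec[OF 3(1)], rule wp_exec[OF 4(1)],
      rule wp_exec[OF 5(1)], blast)
qed

lemma wp_main_prog:
  assumes rank: "ranking D \<pi>"
  shows "wp main_prog (\<lambda>m s'. m \<le> main_time d (length D) \<and>
      ((\<exists>w v. satisfying_solution d D \<pi> k w v) \<longrightarrow>
       satisfying_solution d D \<pi> k (output_weights d s') (output_bonuses (length D) s')))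
     (input_state d D \<pi> k)"
proof -
  let ?n = "length D"
  let ?s = "input_state d D \<pi> k"
  let ?sat = "\<lambda>s. satisfying_solution d D \<pi> k (output_weights d s) (output_bonuses ?n s)"
  have inp: "holds_input d D \<pi> k ?s"
    by (rule holds_input_input_state)
  obtain m1 s1 where 1: "exec count_prog ?s m1 s1" "same {''N'', ''i''} {} ?s s1" "m1 \<le> 15 + d * 50"
    "imem s1 ''N'' 0 = int (?n ^ (2 * d))"
    using inp by - (rule wpE[OF wp_count_prog[of ?s ?n d]], auto simp: holds_input_def)
  have inp1: "holds_input d D \<pi> k s1"
    by (rule holds_input_same[OF inp 1(2)]) auto
  obtain m2 s2 K where 2: "exec power_prog s1 m2 s2" "same {''K'', ''pow'', ''i''} {} s1 s2" "m2 \<le> 15 + ?n * 50"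
    and K: "imem s2 ''K'' 0 = int K" "?n < 2 ^ K" "K \<le> lg ?n" "\<forall>j<K. imem s2 ''pow'' (int j) = 2 ^ j"
    using inp1 by - (rule wpE[OF wp_power_prog[of s1 ?n]], auto simp: holds_input_def)
  have inp2: "holds_input d D \<pi> k s2"
    by (rule holds_input_same[OF inp1 2(2)]) auto
  let ?s2 = "iupdate ''tail'' 0 (-1) s2"
  let ?I = "\<lambda>t s'. imem s' ''tail'' 0 = -1 \<and> (\<forall>j<2 * d. imem s' ''c'' (int j) = int (digit ?n t j)) \<and>
      ((\<exists>t'<t. good d D \<pi> k t') \<longrightarrow> ?sat s')"
  have "wp (for_loop ''t'' (ivar ''N'') body_prog) (\<lambda>m s'. m \<le> icost (ivar ''N'') + 7 +
      ?n ^ (2 * d) * (body_time d ?n + icost (ivar ''N'') + 10) \<and> ?I (?n ^ (2 * d)) s') ?s2"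
  proof (rule wp_for_loop[where I = ?I])
    show "ival (ivar ''N'') s' = int (?n ^ (2 * d))"
      if "same (insert ''t'' (iwrites body_prog)) (rwrites body_prog) ?s2 s'" for s'
      using that 1(4) 2(2) by (simp add: same_def)
    \<comment> \<open>All digits of candidate 0 are 0, which is what the still untouched array
      \<open>c\<close> contains.\<close>
    show "?I 0 ?s2"
      using 1(2) 2(2) by (simp add: same_def input_state_def digit_def)
  next
    fix t s' assume t: "t < ?n ^ (2 * d)" and same: "same (insert ''t'' (iwrites body_prog)) (rwrites body_prog) ?s2 s'"
      and I: "?I t s'"
    have "wp body_prog (\<lambda>m s''. m \<le> body_time d ?n \<and> imem s'' ''tail'' 0 = -1 \<and>
        (\<forall>j<2 * d. imem s'' ''c'' (int j) = int (digit ?n (Suc t) j)) \<and>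
        (good d D \<pi> k t \<or> ?sat s' \<longrightarrow> ?sat s'')) s'"
    proof (rule wp_body_prog[OF rank])
      show "holds_input d D \<pi> k s'"
        using inp2 same by (simp add: holds_input_def same_def)
      \<comment> \<open>With n = 0 and d > 0 there are no candidates, because
        \<open>0 ^ (2 * d) = 0\<close>, so the body is never entered.\<close>
      show "0 < d \<longrightarrow> 0 < ?n"
        using t by (cases "?n = 0") (auto simp: power_0_left split: if_splits)
      show "imem s' ''K'' 0 = int K" "\<forall>j<K. imem s' ''pow'' (int j) = 2 ^ j"
        using K same by (simp_all add: same_def)
    qed (use I K in auto)
    then show "wp body_prog (\<lambda>m s''. m \<le> body_time d ?n \<and> ?I (Suc t) s'') s'"
      using I by (elim wp_frame) (auto simp: less_Suc_eq)
  qed (auto simp: output_weights_def output_bonuses_def)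
  then obtain m3 s3 where 3: "exec (for_loop ''t'' (ivar ''N'') body_prog) ?s2 m3 s3"
    "m3 \<le> 9 + ?n ^ (2 * d) * (12 + body_time d ?n)" "(\<exists>t'<?n ^ (2 * d). good d D \<pi> k t') \<longrightarrow> ?sat s3"
    by (rule wpE) auto
  have "?sat s3" if sol: "satisfying_solution d D \<pi> k w v" for w v
  proof (cases "?n = 0")
    \<comment> \<open>Without tuples the loop may not run at all. Any vectors of the right
      dimensions then solve the instance, as the given solution shows that k is nonnegative.\<close>
    case True
    then show ?thesis
      using sol rank by (simp add: satisfying_solution_def sorting_produces_iff output_weights_def output_bonuses_def)
  next
    case False
    then show ?thesis
      using ex_good[OF rank sol] 3(3) by simp
  qed
  moreover have "3 + m1 + m2 + m3 + 10 \<le> main_time d ?n"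
    using 1(3) 2(3) 3(2) by (simp add: main_time_def)
  ultimately show ?thesis
    unfolding main_prog_def
    by simp (rule wp_exec[OF 1(1)], rule wp_exec[OF 2(1)], rule wp_exec[OF 3(1)], auto)
qed

section \<open>Asymptotic running time for fixed dimension\<close>

lemma main_time_bigo:
  "(\<lambda>n. real (main_time d n)) \<in> O(\<lambda>n. real n ^ (2 * d + 1) * ln (real n))"
proof -
  define A where "A = solve_time d + 200 + d * 100 + 12"
  define B where "B = 200 + d * 38"
  define C where "C = 100 + d * 50 + 50 + (A + B + 60)"
  have bound: "main_time d n \<le> C * (n ^ (2 * d) * (n * lg n))" if "1 \<le> n" for n
  proof -
    let ?X = "n * lg n" and ?M = "n ^ (2 * d)"
    have lg: "1 \<le> lg n"
      by (simp add: lg_def)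
    have X: "1 \<le> ?X" "n \<le> ?X"
      using that lg by (simp_all add: Suc_le_eq)
    have M: "1 \<le> ?M"
      using that by simp
    have "12 + body_time d n = A + B * n + 60 * ?X"
      by (simp add: body_time_def A_def B_def algebra_simps)
    also have "\<dots> \<le> A * ?X + B * ?X + 60 * ?X"
      using X by (intro add_mono mult_le_mono2) simp_all
    finally have body: "12 + body_time d n \<le> (A + B + 60) * ?X"
      by (simp add: distrib_right)
    have "?X \<le> ?M * ?X"
      using M by simp
    then have "1 \<le> ?M * ?X" "n \<le> ?M * ?X"
      using X by linarith+
    then have "main_time d n \<le> (100 + d * 50) * (?M * ?X) + 50 * (?M * ?X) + ?M * ((A + B + 60) * ?X)"
      unfolding main_time_def using body
      by (intro add_mono mult_le_mono2) (simp_all add: mult.commute)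
    then show ?thesis
      by (simp add: C_def algebra_simps)
  qed
  \<comment> \<open>From 3 on, n is at least e, so \<open>ln n >= 1\<close> absorbs the additive 1
    of \<open>lg\<close>. With \<open>ln 2 >= 1 / 2\<close> this gives
    \<open>lg n <= 1 + 2 * ln n\<close>, and the factor 4 leaves slack.\<close>
  have lg_le: "real (lg n) \<le> 4 * ln (real n)" if "3 \<le> n" for n
  proof -
    have "exp 1 \<le> real n"
      using exp_le that by linarith
    then have ln: "1 \<le> ln (real n)"
      using that by (simp add: ln_ge_iff)
    have ln2: "1 / 2 \<le> ln (2 :: real)"
    proof -
      have "1 \<le> ln ((2::real) ^ 2)"
        using exp_le by (subst ln_ge_iff) simp_all
      then show ?thesis
        by (subst (asm) ln_realpow) simp_all
    qed
    have "real (lg n) \<le> 1 + log 2 (real n)"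
      using that by (simp add: lg_def)
    also have "log 2 (real n) = ln (real n) / ln 2"
      by (simp add: log_def)
    also have "\<dots> \<le> ln (real n) / (1 / 2)"
      using ln ln2 by (intro divide_left_mono) auto
    finally show ?thesis
      using ln by simp
  qed
  have "real (main_time d n) \<le> 4 * real C * (real n ^ (2 * d + 1) * ln (real n))" if n: "3 \<le> n" for n
  proof -
    have "real (main_time d n) \<le> real (C * (n ^ (2 * d) * (n * lg n)))"
      using bound[of n] n by (subst of_nat_le_iff) simp
    also have "\<dots> = real C * real n ^ (2 * d + 1) * real (lg n)"
      by simp
    also have "\<dots> \<le> real C * real n ^ (2 * d + 1) * (4 * ln (real n))"
      using lg_le[OF n] by (intro mult_left_mono) auto
    finally show ?thesis
      by (simp add: mult_ac)
  qed
  then show ?thesis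
    by (intro bigoI[where c = "4 * real C"] eventually_sequentiallyI[of 3]) auto
qed

text \<open>One program serves all dimensions, since d is part of its input; only the constant
  hidden by the O depends on d.\<close>

theorem theorem3p1:
  "\<exists>(P :: com) (T :: nat \<Rightarrow> nat \<Rightarrow> nat).
     (\<forall>d. (\<lambda>n. real (T d n)) \<in> O(\<lambda>n. real n ^ (2 * d + 1) * ln (real n))) \<and>
     (\<forall>(d :: nat) (D :: real vec list) (\<pi> :: nat list) (k :: int).
        tuple_set d D \<longrightarrow> ranking D \<pi> \<longrightarrow>
        (\<exists>m s. exec P (input_state d D \<pi> k) m s \<and> m \<le> T d (length D) \<and>
           ((\<exists>w v. satisfying_solution d D \<pi> k w v) \<longrightarrow>
            satisfying_solution d D \<pi> k
              (output_weights d s) (output_bonuses (length D) s))))"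
  using main_time_bigo wp_main_prog unfolding wp_def by blast

end
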